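(* Let $(X_n)_{n\in\omega}$ be a tower of uniform spaces and let $(C_n)_{n\in\omega}$ be a sequence of pointed topological spaces. (i) If for every $n\in\omega$ the space $X_n$ is $C_n$-complemented in $X_{n+1}$ and $X_n$ is homeomorphic to the product $X_0\times\boxdot_{i<n}C_i$, then the uniform direct limit $\mathrm{u}\text{-}\varinjlim X_n$ is homeomorphic to $X_0\times\boxdot_{n\in\omega}C_n$. (ii) If for every $n\in\omega$ the space $X_n$ is locally $C_n$-complemented in $X_{n+1}$ and $X_n$ is locally homeomorphic to the product $X_0\times\boxdot_{i<n}C_i$, then the uniform direct limit $\mathrm{u}\text{-}\varinjlim X_n$ is locally homeomorphic to $X_0\times\boxdot_{n\in\omega}C_n$.
   Context: All topological spaces are completely regular (Hausdorff), uniform spaces are Hausdorff; $\omega=\{0,1,2,\dots\}$. The uniformity of a uniform space $X$ is denoted $\mathcal U_X$; its elements are called entourages. For $a\in X$, $A\subset X$, $U\in\mathcal U_X$ put $B(a,U)=\{x\in X:(x,a)\in U\}$ and $B(A,U)=\bigcup_{a\in A}B(a,U)$. A neighborhood of $A$ in $X$ is uniform if it contains $B(A,U)$ for some $U\in\mathcal U_X$. A tower of uniform spaces is an increasing sequence $X_0\subset X_1\subset X_2\subset\cdots$ of uniform spaces such that the uniformity of each $X_n$ coincides with the one inherited from $X_{n+1}$. Its uniform direct limit $\mathrm{u}\text{-}\varinjlim X_n$ is the union $\bigcup_{n\in\omega}X_n$ endowed with the largest uniformity making all inclusions $X_n\to\bigcup_{k}X_k$ uniformly continuous (and with the topology generated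 by this uniformity). A pointed space is a space $X$ with a distinguished point $*_X$. For pointed spaces $X_n$, $n\in\omega$, the small box-product is $\boxdot_{n\in\omega}X_n=\{(x_n)_{n\in\omega}\in\square_{n\in\omega}X_n:\exists m\ \forall n\ge m\ x_n=*_{X_n}\}$ with the subspace topology, where $\square_{n\in\omega}X_n$ is the Cartesian product $\prod_n X_n$ with the box topology (generated by all products $\prod_n U_n$ of open sets $U_n\subset X_n$). $\boxdot_{i<n}X_i$ is the subspace of those sequences whose coordinates differ from the distinguished points only at indices $i<n$ (it is identified with the finite product $\prod_{i<n}X_i$). Let $C$ be a pointed topological space. A subset $A$ of a uniform space $X$ is $C$-complemented in $X$ if there is a homeomorphism $\gamma:A\times C\to X$ such that (1) for any neighborhood $V\subset C$ of $*_C$ there is $U\in\mathcal U_X$ with $B(A,U)\subset\gamma(A\times V)$; (2) for any $U\in\mathcal U_X$ there is a neighborhood $V\subset C$ of $*_C$ such that $\gamma(\{a\}\times V)\subset B(a,U)$ for each $a\in A$. The set $A$ is locally $C$-complemented in $X$ if for some open neighborhood $V\subset C$ of $*_C$ (pointed by $*_C$) the set $A$ is $V$-complemented in some open uniform neighborhood of $A$ in $X$. A space $X$ is locally homeomorphic to a space $Y$ if each point of $X$ has an open neighborhood homeomorphic to an open subspace of $Y$. *)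

theory Defs
  imports "HOL-Analysis.Analysis"
begin

section \<open>Uniformities on a carrier set\<close>

text \<open>
  The library's class \<open>uniform_space\<close> fixes one uniformity per type. A tower needs a different
  uniformity on each of an increasing family of sets, so a uniform space is given here by a carrier
  set together with its set of entourages (relations on the carrier).
\<close>

definition uniform_structure :: "'a set \<Rightarrow> 'a rel set \<Rightarrow> bool" where
  "uniform_structure X \<U> \<longleftrightarrow>
     X \<times> X \<in> \<U> \<and>
     (\<forall>E\<in>\<U>. E \<subseteq> X \<times> X \<and> Id_on X \<subseteq> E \<and> E\<inverse> \<in> \<U> \<and> (\<exists>F\<in>\<U>. F O F \<subseteq> E)) \<and>
     (\<forall>E\<in>\<U>. \<forall>F\<in>\<U>. E \<inter> F \<in> \<U>) \<and>
     (\<forall>E\<in>\<U>. \<forall>F. E \<subseteq> F \<and> F \<subseteq> X \<times> X \<longrightarrow> F \<in> \<U>)"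

lemma uniform_structureD:
  assumes "uniform_structure X \<U>"
  shows "X \<times> X \<in> \<U>"
    and "E \<in> \<U> \<Longrightarrow> E \<subseteq> X \<times> X"
    and "E \<in> \<U> \<Longrightarrow> Id_on X \<subseteq> E"
    and "E \<in> \<U> \<Longrightarrow> E\<inverse> \<in> \<U>"
    and "E \<in> \<U> \<Longrightarrow> \<exists>F\<in>\<U>. F O F \<subseteq> E"
    and "E \<in> \<U> \<Longrightarrow> F \<in> \<U> \<Longrightarrow> E \<inter> F \<in> \<U>"
    and "E \<in> \<U> \<Longrightarrow> E \<subseteq> F \<Longrightarrow> F \<subseteq> X \<times> X \<Longrightarrow> F \<in> \<U>"
proof -
  note U = assms[unfolded uniform_structure_def]
  note ent = U[THEN conjunct2, THEN conjunct1, THEN bspec]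
  show "X \<times> X \<in> \<U>"
    by (rule U[THEN conjunct1])
  show "E \<in> \<U> \<Longrightarrow> E \<subseteq> X \<times> X" "E \<in> \<U> \<Longrightarrow> Id_on X \<subseteq> E" "E \<in> \<U> \<Longrightarrow> E\<inverse> \<in> \<U>"
    "E \<in> \<U> \<Longrightarrow> \<exists>F\<in>\<U>. F O F \<subseteq> E"
    by (drule ent, elim conjE, assumption)+
  show "E \<in> \<U> \<Longrightarrow> F \<in> \<U> \<Longrightarrow> E \<inter> F \<in> \<U>"
    by (rule U[THEN conjunct2, THEN conjunct2, THEN conjunct1, rule_format])
  show "E \<in> \<U> \<Longrightarrow> E \<subseteq> F \<Longrightarrow> F \<subseteq> X \<times> X \<Longrightarrow> F \<in> \<U>"
    by (rule U[THEN conjunct2, THEN conjunct2, THEN conjunct2, rule_format, OF _ conjI])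
qed

definition hausdorff_uniform_structure :: "'a set \<Rightarrow> 'a rel set \<Rightarrow> bool" where
  "hausdorff_uniform_structure X \<U> \<longleftrightarrow> uniform_structure X \<U> \<and> \<Inter>\<U> = Id_on X"

definition ent_ball :: "'a set \<Rightarrow> 'a \<Rightarrow> 'a rel \<Rightarrow> 'a set" where
  "ent_ball X a E = {x \<in> X. (x, a) \<in> E}"

definition ent_nbhd :: "'a set \<Rightarrow> 'a set \<Rightarrow> 'a rel \<Rightarrow> 'a set" where
  "ent_nbhd X A E = (\<Union>a\<in>A. ent_ball X a E)"

definition uniform_topology :: "'a set \<Rightarrow> 'a rel set \<Rightarrow> 'a topology" where
  "uniform_topology X \<U> = topology (\<lambda>G. G \<subseteq> X \<and> (\<forall>a\<in>G. \<exists>E\<in>\<U>. ent_ball X a E \<subseteq> G))"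

definition induced_uniformity :: "'a set \<Rightarrow> 'a rel set \<Rightarrow> 'a rel set" where
  "induced_uniformity A \<U> = (\<lambda>E. E \<inter> A \<times> A) ` \<U>"

definition uniformly_continuous_map ::
    "'a set \<Rightarrow> 'a rel set \<Rightarrow> 'b set \<Rightarrow> 'b rel set \<Rightarrow> ('a \<Rightarrow> 'b) \<Rightarrow> bool" where
  "uniformly_continuous_map X \<U> Y \<V> f \<longleftrightarrow>
     f \<in> X \<rightarrow> Y \<and> (\<forall>E\<in>\<V>. {(x, y) \<in> X \<times> X. (f x, f y) \<in> E} \<in> \<U>)"

definition uniform_neighborhood :: "'a set \<Rightarrow> 'a rel set \<Rightarrow> 'a set \<Rightarrow> 'a set \<Rightarrow> bool" where
  "uniform_neighborhood X \<U> A N \<longleftrightarrow> N \<subseteq> X \<and> (\<exists>E\<in>\<U>. ent_nbhd X A E \<subseteq> N)"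

lemma istopology_uniform:
  assumes "uniform_structure X \<U>"
  shows "istopology (\<lambda>G. G \<subseteq> X \<and> (\<forall>a\<in>G. \<exists>E\<in>\<U>. ent_ball X a E \<subseteq> G))"
  unfolding istopology_def
proof (intro conjI allI impI ballI)
  fix S T a
  assume S: "S \<subseteq> X \<and> (\<forall>a\<in>S. \<exists>E\<in>\<U>. ent_ball X a E \<subseteq> S)"
    and T: "T \<subseteq> X \<and> (\<forall>a\<in>T. \<exists>E\<in>\<U>. ent_ball X a E \<subseteq> T)"
  show "S \<inter> T \<subseteq> X"
    using S by blast
  assume "a \<in> S \<inter> T"
  then obtain E F where EF: "E \<in> \<U>" "F \<in> \<U>" "ent_ball X a E \<subseteq> S" "ent_ball X a F \<subseteq> T"
    using S T by (meson IntD1 IntD2)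
  have "ent_ball X a (E \<inter> F) = ent_ball X a E \<inter> ent_ball X a F"
    unfolding ent_ball_def by blast
  then show "\<exists>E\<in>\<U>. ent_ball X a E \<subseteq> S \<inter> T"
    using EF uniform_structureD(6)[OF assms EF(1,2)] by (intro bexI[of _ "E \<inter> F"]) auto
next
  fix K a
  assume K: "\<forall>S\<in>K. S \<subseteq> X \<and> (\<forall>a\<in>S. \<exists>E\<in>\<U>. ent_ball X a E \<subseteq> S)"
  show "\<Union>K \<subseteq> X"
    using K by blast
  assume "a \<in> \<Union>K"
  then obtain S where S: "S \<in> K" "a \<in> S"
    by blast
  then obtain E where "E \<in> \<U>" "ent_ball X a E \<subseteq> S"
    using K by meson
  then show "\<exists>E\<in>\<U>. ent_ball X a E \<subseteq> \<Union>K"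
    using S(1) by blast
qed

lemma openin_uniform_topology:
  assumes "uniform_structure X \<U>"
  shows "openin (uniform_topology X \<U>) G \<longleftrightarrow>
           G \<subseteq> X \<and> (\<forall>a\<in>G. \<exists>E\<in>\<U>. ent_ball X a E \<subseteq> G)"
  using istopology_uniform[OF assms] by (simp add: uniform_topology_def)

lemma topspace_uniform_topology:
  assumes "uniform_structure X \<U>"
  shows "topspace (uniform_topology X \<U>) = X"
proof -
  have "X \<times> X \<in> \<U>"
    by (rule uniform_structureD(1)[OF assms])
  then have "openin (uniform_topology X \<U>) X"
    unfolding openin_uniform_topology[OF assms] ent_ball_def by blast
  moreover have "topspace (uniform_topology X \<U>) \<subseteq> X"
    using openin_topspace[of "uniform_topology X \<U>"] openin_uniform_topology[OF assms] by blast
  ultimately show ?thesis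
    by (simp add: openin_subset subset_antisym)
qed


section \<open>Towers and uniform direct limits\<close>

definition uniform_tower :: "(nat \<Rightarrow> 'a set) \<Rightarrow> (nat \<Rightarrow> 'a rel set) \<Rightarrow> bool" where
  "uniform_tower X \<U> \<longleftrightarrow>
     (\<forall>n. hausdorff_uniform_structure (X n) (\<U> n) \<and> X n \<subseteq> X (Suc n) \<and>
          \<U> n = induced_uniformity (X n) (\<U> (Suc n)))"

definition inclusions_uniformly_continuous ::
    "(nat \<Rightarrow> 'a set) \<Rightarrow> (nat \<Rightarrow> 'a rel set) \<Rightarrow> 'a rel set \<Rightarrow> bool" where
  "inclusions_uniformly_continuous X \<U> \<W> \<longleftrightarrow>
     (\<forall>n. uniformly_continuous_map (X n) (\<U> n) (\<Union>k. X k) \<W> (\<lambda>x. x))"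

text \<open>
  Uniformities are ordered by inclusion, so the largest one has the most entourages. The Hausdorff
  property is not imposed on the competing uniformities; any uniformity that is larger than a
  Hausdorff one is Hausdorff itself. That the maximum is attained is shown by
  \<open>direct_limit_uniformity_greatest\<close> below.
\<close>

definition direct_limit_uniformity :: "(nat \<Rightarrow> 'a set) \<Rightarrow> (nat \<Rightarrow> 'a rel set) \<Rightarrow> 'a rel set" where
  "direct_limit_uniformity X \<U> =
     (GREATEST \<W>. uniform_structure (\<Union>n. X n) \<W> \<and> inclusions_uniformly_continuous X \<U> \<W>)"

definition uniform_direct_limit :: "(nat \<Rightarrow> 'a set) \<Rightarrow> (nat \<Rightarrow> 'a rel set) \<Rightarrow> 'a topology" where
  "uniform_direct_limit X \<U> = uniform_topology (\<Union>n. X n) (direct_limit_uniformity X \<U>)"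

lemma uniform_structure_join:
  assumes "uniform_structure X \<V>" "uniform_structure X \<W>"
  shows "uniform_structure X {E. E \<subseteq> X \<times> X \<and> (\<exists>F\<in>\<V>. \<exists>G\<in>\<W>. F \<inter> G \<subseteq> E)}" (is "uniform_structure X ?J")
proof -
  have V: "F \<inter> F' \<in> \<V>" if "F \<in> \<V>" "F' \<in> \<V>" for F F'
    by (rule uniform_structureD(6)[OF assms(1) that])
  have W: "F \<inter> F' \<in> \<W>" if "F \<in> \<W>" "F' \<in> \<W>" for F F'
    by (rule uniform_structureD(6)[OF assms(2) that])
  have top: "X \<times> X \<in> ?J"
    using uniform_structureD(1)[OF assms(1)] uniform_structureD(1)[OF assms(2)] by blast
  have ent: "E \<subseteq> X \<times> X \<and> Id_on X \<subseteq> E \<and> E\<inverse> \<in> ?J \<and> (\<exists>F\<in>?J. F O F \<subseteq> E)" if E: "E \<in> ?J" for E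
  proof -
    obtain F G where FG: "F \<in> \<V>" "G \<in> \<W>" "F \<inter> G \<subseteq> E" and EX: "E \<subseteq> X \<times> X"
      using E by blast
    have F: "F \<subseteq> X \<times> X" "Id_on X \<subseteq> F" "F\<inverse> \<in> \<V>" "\<exists>F'\<in>\<V>. F' O F' \<subseteq> F"
      using uniform_structureD[OF assms(1)] FG(1) by simp_all
    have G: "G \<subseteq> X \<times> X" "Id_on X \<subseteq> G" "G\<inverse> \<in> \<W>" "\<exists>G'\<in>\<W>. G' O G' \<subseteq> G"
      using uniform_structureD[OF assms(2)] FG(2) by simp_all
    obtain F' G' where H: "F' \<in> \<V>" "F' O F' \<subseteq> F" "G' \<in> \<W>" "G' O G' \<subseteq> G"
      using F(4) G(4) by blast
    have HX: "F' \<subseteq> X \<times> X"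
      using uniform_structureD(2)[OF assms(1) H(1)] .
    have "F\<inverse> \<inter> G\<inverse> \<subseteq> E\<inverse>" "E\<inverse> \<subseteq> X \<times> X"
      using FG(3) EX by auto
    then have "E\<inverse> \<in> ?J"
      using F(3) G(3) by blast
    moreover have "F' \<inter> G' \<in> ?J"
      using H HX by blast
    moreover have "(F' \<inter> G') O (F' \<inter> G') \<subseteq> E"
      using H(2,4) FG(3) by blast
    ultimately show ?thesis
      using EX F(2) G(2) FG(3) by blast
  qed
  have int: "E \<inter> E' \<in> ?J" if EE: "E \<in> ?J" "E' \<in> ?J" for E E'
  proof -
    obtain F G F' G' where "F \<in> \<V>" "G \<in> \<W>" "F \<inter> G \<subseteq> E" "F' \<in> \<V>" "G' \<in> \<W>" "F' \<inter> G' \<subseteq> E'"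
      using EE by blast
    then have "F \<inter> F' \<in> \<V>" "G \<inter> G' \<in> \<W>" "(F \<inter> F') \<inter> (G \<inter> G') \<subseteq> E \<inter> E'"
      using V W by auto
    then show ?thesis
      using EE by blast
  qed
  have up: "F \<in> ?J" if "E \<in> ?J" "E \<subseteq> F" "F \<subseteq> X \<times> X" for E F
    using that by blast
  show ?thesis
    unfolding uniform_structure_def
    by (intro conjI ballI allI impI; (elim conjE)?) (fact top | simp only: ent | fact int | fact up)+
qed

lemma inclusions_uniformly_continuous_join:
  assumes tower: "uniform_tower X \<U>"
    and "inclusions_uniformly_continuous X \<U> \<V>" "inclusions_uniformly_continuous X \<U> \<W>"
  shows "inclusions_uniformly_continuous X \<U>
           {E. E \<subseteq> (\<Union>n. X n) \<times> (\<Union>n. X n) \<and> (\<exists>F\<in>\<V>. \<exists>G\<in>\<W>. F \<inter> G \<subseteq> E)}"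
  unfolding inclusions_uniformly_continuous_def uniformly_continuous_map_def
proof (intro allI conjI ballI)
  fix n
  show "(\<lambda>x. x) \<in> X n \<rightarrow> (\<Union>k. X k)"
    by blast
  let ?r = "\<lambda>E. {(x, y) \<in> X n \<times> X n. (x, y) \<in> E}"
  fix E assume "E \<in> {E. E \<subseteq> (\<Union>n. X n) \<times> (\<Union>n. X n) \<and> (\<exists>F\<in>\<V>. \<exists>G\<in>\<W>. F \<inter> G \<subseteq> E)}"
  then obtain F G where FG: "F \<in> \<V>" "G \<in> \<W>" "F \<inter> G \<subseteq> E"
    by blast
  have "?r F \<in> \<U> n" "?r G \<in> \<U> n"
    using assms(2,3) FG
    unfolding inclusions_uniformly_continuous_def uniformly_continuous_map_def by simp_all
  moreover have U: "uniform_structure (X n) (\<U> n)"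
    using tower unfolding uniform_tower_def hausdorff_uniform_structure_def by blast
  ultimately have "?r F \<inter> ?r G \<in> \<U> n"
    using uniform_structureD(6) by blast
  moreover have "?r F \<inter> ?r G \<subseteq> ?r E" "?r E \<subseteq> X n \<times> X n"
    using FG(3) by auto
  ultimately show "?r E \<in> \<U> n"
    by (rule uniform_structureD(7)[OF U])
qed

lemma direct_limit_uniformity_greatest:
  assumes tower: "uniform_tower X \<U>"
  shows "uniform_structure (\<Union>n. X n) (direct_limit_uniformity X \<U>)"
    and "inclusions_uniformly_continuous X \<U> (direct_limit_uniformity X \<U>)"
    and "\<And>\<W>. uniform_structure (\<Union>n. X n) \<W> \<Longrightarrow> inclusions_uniformly_continuous X \<U> \<W> \<Longrightarrow>
              \<W> \<subseteq> direct_limit_uniformity X \<U>"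
proof -
  define Y where "Y = (\<Union>n. X n)"
  define P where "P = (\<lambda>\<W>. uniform_structure Y \<W> \<and> inclusions_uniformly_continuous X \<U> \<W>)"
  define M where "M = \<Union>{\<W>. P \<W>}"
  have U: "uniform_structure (X n) (\<U> n)" for n
    using tower unfolding uniform_tower_def hausdorff_uniform_structure_def by blast
  have "uniform_structure Y {Y \<times> Y}"
    unfolding uniform_structure_def by auto
  moreover have "inclusions_uniformly_continuous X \<U> {Y \<times> Y}"
  proof -
    have "{(x, y) \<in> X n \<times> X n. (x, y) \<in> Y \<times> Y} = X n \<times> X n" for n
      unfolding Y_def by blast
    moreover have "X n \<times> X n \<in> \<U> n" for n
      using uniform_structureD(1)[OF U] .
    ultimately show ?thesis
      unfolding inclusions_uniformly_continuous_def uniformly_continuous_map_def by auto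
  qed
  ultimately have triv: "P {Y \<times> Y}"
    unfolding P_def by blast
  have M_struct: "uniform_structure Y M"
    unfolding uniform_structure_def
  proof (intro conjI ballI allI impI)
    show "Y \<times> Y \<in> M"
      using triv unfolding M_def by blast
  next
    fix E assume "E \<in> M"
    then obtain \<W> where W: "P \<W>" "E \<in> \<W>"
      unfolding M_def by blast
    then have sub: "\<W> \<subseteq> M" and S: "uniform_structure Y \<W>"
      unfolding M_def P_def by blast+
    show "E \<subseteq> Y \<times> Y" "Id_on Y \<subseteq> E"
      using uniform_structureD[OF S] W(2) by simp_all
    have "E\<inverse> \<in> \<W>" "\<exists>F\<in>\<W>. F O F \<subseteq> E"
      using uniform_structureD[OF S] W(2) by simp_all
    then show "E\<inverse> \<in> M" "\<exists>F\<in>M. F O F \<subseteq> E"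
      using sub by blast+
    show "F \<in> M" if "E \<subseteq> F \<and> F \<subseteq> Y \<times> Y" for F
    proof -
      have "F \<in> \<W>"
        using uniform_structureD(7)[OF S W(2)] that by simp
      then show ?thesis
        using sub by blast
    qed
  next
    fix E F assume "E \<in> M" "F \<in> M"
    then obtain \<V> \<W> where VW: "P \<V>" "E \<in> \<V>" "P \<W>" "F \<in> \<W>"
      unfolding M_def by blast
    let ?J = "{E. E \<subseteq> Y \<times> Y \<and> (\<exists>F\<in>\<V>. \<exists>G\<in>\<W>. F \<inter> G \<subseteq> E)}"
    have "P ?J"
      using VW(1,3) uniform_structure_join[of Y \<V> \<W>]
        inclusions_uniformly_continuous_join[OF tower, of \<V> \<W>]
      unfolding P_def Y_def by blast
    moreover have "E \<subseteq> Y \<times> Y"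
      using uniform_structureD(2) VW(1,2) unfolding P_def by blast
    then have "E \<inter> F \<in> ?J"
      using VW(2,4) by blast
    ultimately show "E \<inter> F \<in> M"
      unfolding M_def by blast
  qed
  have "inclusions_uniformly_continuous X \<U> M"
    unfolding inclusions_uniformly_continuous_def uniformly_continuous_map_def
  proof (intro allI conjI ballI)
    fix n
    show "(\<lambda>x. x) \<in> X n \<rightarrow> (\<Union>k. X k)"
      by blast
    fix E assume "E \<in> M"
    then obtain \<W> where "inclusions_uniformly_continuous X \<U> \<W>" "E \<in> \<W>"
      unfolding M_def P_def by blast
    then show "{(x, y) \<in> X n \<times> X n. (x, y) \<in> E} \<in> \<U> n"
      unfolding inclusions_uniformly_continuous_def uniformly_continuous_map_def by blast
  qed
  with M_struct have PM: "P M"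
    unfolding P_def by blast
  have ub: "\<W> \<subseteq> M" if "P \<W>" for \<W>
    using that unfolding M_def by blast
  have "direct_limit_uniformity X \<U> = (GREATEST \<W>. P \<W>)"
    unfolding direct_limit_uniformity_def P_def Y_def ..
  also have "\<dots> = M"
    using PM ub by (rule Greatest_equality)
  finally have eq: "direct_limit_uniformity X \<U> = M" .
  show "uniform_structure (\<Union>n. X n) (direct_limit_uniformity X \<U>)"
    and "inclusions_uniformly_continuous X \<U> (direct_limit_uniformity X \<U>)"
    and "\<And>\<W>. uniform_structure (\<Union>n. X n) \<W> \<Longrightarrow> inclusions_uniformly_continuous X \<U> \<W> \<Longrightarrow>
              \<W> \<subseteq> direct_limit_uniformity X \<U>"
    using PM ub unfolding eq P_def Y_def by blast+
qed


section \<open>Small box-products of pointed spaces\<close>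

definition box_topology :: "(nat \<Rightarrow> 'c topology) \<Rightarrow> (nat \<Rightarrow> 'c) topology" where
  "box_topology C = topology_generated_by {Pi UNIV G |G. \<forall>n. openin (C n) (G n)}"

definition small_box_product :: "(nat \<Rightarrow> 'c topology) \<Rightarrow> (nat \<Rightarrow> 'c) \<Rightarrow> (nat \<Rightarrow> 'c) topology" where
  "small_box_product C c = subtopology (box_topology C) {x. \<exists>m. \<forall>n\<ge>m. x n = c n}"

definition finite_box_product ::
    "(nat \<Rightarrow> 'c topology) \<Rightarrow> (nat \<Rightarrow> 'c) \<Rightarrow> nat \<Rightarrow> (nat \<Rightarrow> 'c) topology" where
  "finite_box_product C c n = subtopology (small_box_product C c) {x. \<forall>i\<ge>n. x i = c i}"

lemma topspace_box_topology: "topspace (box_topology C) = {x. \<forall>n. x n \<in> topspace (C n)}"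
proof -
  have "openin (C n) (G n) \<Longrightarrow> G n \<subseteq> topspace (C n)" for G n
    by (rule openin_subset)
  then have "\<Union>{Pi UNIV G |G. \<forall>n. openin (C n) (G n)} \<subseteq> Pi UNIV (\<lambda>n. topspace (C n))"
    by (fastforce simp: Pi_iff)
  moreover have "Pi UNIV (\<lambda>n. topspace (C n)) \<subseteq> \<Union>{Pi UNIV G |G. \<forall>n. openin (C n) (G n)}"
    by (rule Union_upper) blast
  ultimately show ?thesis
    unfolding box_topology_def topology_generated_by_topspace by (auto simp: Pi_iff)
qed


section \<open>Complemented sets and local homeomorphy\<close>

definition pt_neighborhood :: "'c topology \<Rightarrow> 'c \<Rightarrow> 'c set \<Rightarrow> bool" where
  "pt_neighborhood C c V \<longleftrightarrow> V \<subseteq> topspace C \<and> (\<exists>G. openin C G \<and> c \<in> G \<and> G \<subseteq> V)"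

definition complemented :: "'c topology \<Rightarrow> 'c \<Rightarrow> 'a set \<Rightarrow> 'a rel set \<Rightarrow> 'a set \<Rightarrow> bool" where
  "complemented C c X \<U> A \<longleftrightarrow>
     A \<subseteq> X \<and>
     (\<exists>\<gamma>. homeomorphic_map (prod_topology (subtopology (uniform_topology X \<U>) A) C)
                           (uniform_topology X \<U>) \<gamma> \<and>
          (\<forall>V. pt_neighborhood C c V \<longrightarrow> (\<exists>E\<in>\<U>. ent_nbhd X A E \<subseteq> \<gamma> ` (A \<times> V))) \<and>
          (\<forall>E\<in>\<U>. \<exists>V. pt_neighborhood C c V \<and> (\<forall>a\<in>A. \<gamma> ` ({a} \<times> V) \<subseteq> ent_ball X a E)))"

definition locally_complemented :: "'c topology \<Rightarrow> 'c \<Rightarrow> 'a set \<Rightarrow> 'a rel set \<Rightarrow> 'a set \<Rightarrow> bool" where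
  "locally_complemented C c X \<U> A \<longleftrightarrow>
     A \<subseteq> X \<and>
     (\<exists>V N. openin C V \<and> c \<in> V \<and>
            openin (uniform_topology X \<U>) N \<and> uniform_neighborhood X \<U> A N \<and>
            complemented (subtopology C V) c N (induced_uniformity N \<U>) A)"

definition locally_homeomorphic_to :: "'a topology \<Rightarrow> 'b topology \<Rightarrow> bool" where
  "locally_homeomorphic_to S T \<longleftrightarrow>
     (\<forall>x\<in>topspace S. \<exists>G H. openin S G \<and> x \<in> G \<and> openin T H \<and>
        subtopology S G homeomorphic_space subtopology T H)"

end

theory Submission
  imports Defs
begin

text \<open>
  Iterating the charts \<open>X n \<times> V n \<rightarrow> X (n + 1)\<close>, starting from a chart of an open subset of \<open>X m\<close>,
  gives an injective map from an open subset of the product of \<open>X 0\<close> and the small box-product to the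
  limit; its image is the whole limit in case (i) and contains a prescribed point in case (ii). It
  is continuous because, by condition (2), the displacement caused by the \<open>n\<close>-th coordinate can be
  kept in an entourage \<open>E n\<close>, where \<open>E (n + 1) \<circ> E (n + 1) \<subseteq> E n\<close>. It is open because the image of a
  basic box is a union of sets \<open>Q n\<close> with \<open>Q (n + 1) = \<gamma> n (Q n \<times> W n)\<close>, and conditions (1) and (2)
  together show that a set lying uniformly inside \<open>Q n\<close> in \<open>X n\<close> lies uniformly inside \<open>Q (n + 1)\<close>
  in \<open>X (n + 1)\<close>. This permits the construction of a real function on the limit, uniformly continuous
  on each \<open>X n\<close>, that separates a point of the union from its complement. Such a function is
  uniformly continuous for the largest uniformity, so no explicit description of the entourages of
  the limit is needed.
\<close>

section \<open>Extension of uniformly continuous functions\<close>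

inductive chain :: "(nat \<Rightarrow> 'a rel) \<Rightarrow> nat \<Rightarrow> 'a \<Rightarrow> 'a \<Rightarrow> real \<Rightarrow> bool" for U where
  chain_0: "chain U 0 x x 0"
| chain_Suc: "chain U n x y s \<Longrightarrow> (y, z) \<in> U k \<Longrightarrow> chain U (Suc n) x z (s + (1/2) ^ k)"

lemma chain_nonneg: "chain U n x y s \<Longrightarrow> 0 \<le> s"
  by (induction rule: chain.induct) auto

lemma chain_single: "(x, y) \<in> U k \<Longrightarrow> chain U 1 x y ((1/2) ^ k)"
  using chain_Suc[OF chain_0, of x y U k] by simp

lemma chain_trans:
  assumes "chain U n y z t" "chain U m x y s"
  shows "chain U (m + n) x z (s + t)"
  using assms
proof (induction rule: chain.induct)
  case (chain_Suc n y' u t v k)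
  then have "chain U (Suc (m + n)) x v (s + t + (1/2) ^ k)"
    by (blast intro: chain.chain_Suc)
  then show ?case
    by (simp add: add.assoc)
qed simp

lemma chain_sym:
  assumes "chain U n x y s" "\<And>k. sym (U k)"
  shows "chain U n y x s"
  using assms(1)
proof (induction rule: chain.induct)
  case (chain_Suc n x y s z k)
  have "chain U 1 z y ((1/2) ^ k)"
    using chain_Suc(2) assms(2) by (meson chain_single symD)
  from chain_trans[OF chain_Suc(3) this] show ?case
    by (simp add: add.commute)
qed (rule chain_0)

text \<open>Cut the chain at the step that carries the running cost past \<open>t\<close>. With
  \<open>t = s / 2\<close> both outer pieces cost at most half of the total, and both have fewer
  steps, so an induction on the number of steps applies to them.\<close>

lemma chain_split:
  assumes "chain U n x y s" "0 \<le> t" "t < s"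
  shows "\<exists>n1 n2 u v k s1 s2. chain U n1 x u s1 \<and> (u, v) \<in> U k \<and> chain U n2 v y s2 \<and>
           s1 \<le> t \<and> t < s1 + (1/2) ^ k \<and> s = s1 + (1/2) ^ k + s2 \<and> n1 < n \<and> n2 < n"
  using assms
proof (induction rule: chain.induct)
  case (chain_Suc n x y s z k)
  show ?case
  proof (cases "s \<le> t")
    case True
    then show ?thesis
      using chain_Suc.hyps chain_Suc.prems chain_0[of U z]
      by (intro exI[of _ n] exI[of _ 0] exI[of _ y] exI[of _ z] exI[of _ k] exI[of _ s] exI[of _ 0]) simp
  next
    case False
    then obtain n1 n2 u v j s1 s2 where *: "chain U n1 x u s1" "(u, v) \<in> U j" "chain U n2 v y s2"
      "s1 \<le> t" "t < s1 + (1/2) ^ j" "s = s1 + (1/2) ^ j + s2" "n1 < n" "n2 < n"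
      using chain_Suc.IH chain_Suc.prems by force
    have "chain U (Suc n2) v z (s2 + (1/2) ^ k)"
      using *(3) chain_Suc.hyps(2) by (rule chain.chain_Suc)
    then show ?thesis
      using *
      by (intro exI[of _ n1] exI[of _ "Suc n2"] exI[of _ u] exI[of _ v] exI[of _ j] exI[of _ s1]
          exI[of _ "s2 + (1/2) ^ k"]) simp
  qed
qed simp

text \<open>Cut the chain at half of its cost. The outer pieces cost less than
  \<open>(1/2) ^ Suc k\<close>, so by induction they join pairs in \<open>U (Suc k)\<close>. The
  middle step costs less than \<open>(1/2) ^ k\<close>, so its index is at least
  \<open>Suc k\<close>, and its pair lies in \<open>U (Suc k)\<close> because the \<open>U k\<close>
  decrease. The threefold composition is then inside \<open>U k\<close>.\<close>

lemma chain_short: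
  assumes "\<And>k. Id \<subseteq> U k" and "\<And>k. U (Suc k) O U (Suc k) O U (Suc k) \<subseteq> U k"
    and "chain U n x y s" "s < (1/2) ^ k"
  shows "(x, y) \<in> U k"
  using assms(3,4)
proof (induction n arbitrary: x y s k rule: less_induct)
  case (less n)
  have dec: "U j \<subseteq> U k" if "k \<le> j" for j k
    using that
  proof (induction rule: dec_induct)
    case (step i)
    have "Id O Id O U (Suc i) \<subseteq> U (Suc i) O U (Suc i) O U (Suc i)"
      by (intro relcomp_mono assms(1)) simp
    then have "U (Suc i) \<subseteq> U i"
      using assms(2)[of i] by simp
    then show ?case
      using step.IH by (rule order_trans)
  qed simp
  show ?case
  proof (cases "s = 0")
    \<comment> \<open>Halving needs a positive cost. Every step costs something, so a chain of cost
      0 has no step.\<close>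
    case True
    have "x = y"
      using less.prems(1)
    proof cases
      case (chain_Suc n' y' s' k')
      then have "0 \<le> s'" "(0::real) < (1/2) ^ k'"
        using chain_nonneg by auto
      then show ?thesis
        using True chain_Suc by linarith
    qed simp
    then show ?thesis
      using assms(1) by blast
  next
    case False
    then have "0 < s"
      using chain_nonneg[OF less.prems(1)] by simp
    then obtain n1 n2 u v j s1 s2 where *: "chain U n1 x u s1" "(u, v) \<in> U j" "chain U n2 v y s2"
      "s1 \<le> s / 2" "s / 2 < s1 + (1/2) ^ j" "s = s1 + (1/2) ^ j + s2" "n1 < n" "n2 < n"
      using chain_split[OF less.prems(1), of "s / 2"] by auto
    have "(1/2) ^ Suc k = (1/2::real) ^ k / 2"
      by simp
    then have s: "s1 < (1/2) ^ Suc k" "s2 < (1/2) ^ Suc k"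
      using * less.prems(2) by linarith+
    have "(1/2::real) ^ j < (1/2) ^ k"
      using * less.prems(2) chain_nonneg[OF *(1)] chain_nonneg[OF *(3)] by linarith
    then have "Suc k \<le> j"
      by (simp add: power_strict_decreasing_iff)
    then have "(u, v) \<in> U (Suc k)"
      using *(2) dec by blast
    moreover have "(x, u) \<in> U (Suc k)" "(v, y) \<in> U (Suc k)"
      using less.IH[OF *(7,1) s(1)] less.IH[OF *(8,3) s(2)] by simp_all
    ultimately have "(x, y) \<in> U (Suc k) O U (Suc k) O U (Suc k)"
      by (intro relcompI)
    then show ?thesis
      using assms(2) by (rule subsetD[rotated])
  qed
qed

definition pseudometric :: "('a \<Rightarrow> 'a \<Rightarrow> real) \<Rightarrow> bool" where
  "pseudometric d \<longleftrightarrow> (\<forall>x y. 0 \<le> d x y \<and> d x x = 0 \<and> d x y = d y x) \<and> (\<forall>x y z. d x z \<le> d x y + d y z)"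

text \<open>The distance is the infimum of the costs of chains; \<open>U 0 = UNIV\<close> joins any
  two points at cost 1, so it is finite. One-step chains give the upper estimate and
  \<open>chain_short\<close> gives the lower one without loss of a constant.\<close>

lemma frink_pseudometric:
  fixes U :: "nat \<Rightarrow> 'a rel"
  assumes "U 0 = UNIV" "\<And>k. Id \<subseteq> U k" "\<And>k. sym (U k)"
    and "\<And>k. U (Suc k) O U (Suc k) O U (Suc k) \<subseteq> U k"
  obtains d :: "'a \<Rightarrow> 'a \<Rightarrow> real"
  where "pseudometric d" "\<forall>x y k. (x, y) \<in> U k \<longrightarrow> d x y \<le> (1/2) ^ k"
    and "\<forall>x y k. d x y < (1/2) ^ k \<longrightarrow> (x, y) \<in> U k"
proof -
  define S where "S x y = {s. \<exists>n. chain U n x y s}" for x y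
  define d where "d x y = Inf (S x y)" for x y
  have bdd: "bdd_below (S x y)" for x y
    unfolding S_def bdd_below_def by (auto intro: exI[of _ 0] chain_nonneg)
  have ne: "S x y \<noteq> {}" for x y
    using chain_single[of x y U 0] assms(1) unfolding S_def by auto
  have le: "d x y \<le> s" if "s \<in> S x y" for x y s
    unfolding d_def by (rule cInf_lower[OF that bdd])
  have gt: "\<exists>s\<in>S x y. s < r" if "d x y < r" for x y r
    using cInf_lessD[OF ne] that unfolding d_def by blast
  have nonneg: "0 \<le> d x y" for x y
    unfolding d_def by (rule cInf_greatest[OF ne]) (auto simp: S_def intro: chain_nonneg)
  have refl: "d x x = 0" for x
    using le[of 0 x x] nonneg[of x x] chain_0[of U x] unfolding S_def by (auto intro: antisym)
  have "S x y = S y x" for x y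
    unfolding S_def by (auto intro: chain_sym[OF _ assms(3)])
  then have sym: "d x y = d y x" for x y
    unfolding d_def by simp
  have tri: "d x z \<le> d x y + d y z" for x y z
  proof (rule field_le_epsilon)
    fix e :: real assume "0 < e"
    then obtain s t where "s \<in> S x y" "s < d x y + e / 2" "t \<in> S y z" "t < d y z + e / 2"
      using gt[of x y "d x y + e / 2"] gt[of y z "d y z + e / 2"] by auto
    moreover from this have "s + t \<in> S x z"
      unfolding S_def by (auto intro: chain_trans)
    ultimately show "d x z \<le> d x y + d y z + e"
      using le[of "s + t" x z] by linarith
  qed
  have small: "d x y \<le> (1/2) ^ k" if "(x, y) \<in> U k" for x y k
    using le chain_single[of x y U k] that unfolding S_def by blast
  have close: "(x, y) \<in> U k" if "d x y < (1/2) ^ k" for x y k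
    using gt[OF that] chain_short[of U, OF assms(2,4)] unfolding S_def by blast
  show thesis
    using that[of d] nonneg refl sym tri small close unfolding pseudometric_def by simp
qed

section \<open>Lipschitz bounds and extension of functions with values between 0 and 1\<close>

lemma le_twice_of_dyadic:
  fixes D d :: real
  assumes "0 \<le> d" "D \<le> 1" and le: "\<And>k. d < (1/2) ^ k \<Longrightarrow> D \<le> (1/2) ^ k"
  shows "D \<le> 2 * d"
proof (rule ccontr)
  assume "\<not> D \<le> 2 * d"
  then have *: "2 * d < D"
    by simp
  then obtain k0 where k0: "(1/2) ^ k0 < D"
    using assms(1) real_arch_pow_inv[of D "1/2"] by auto
  \<comment> \<open>The least such \<open>k\<close> is positive because \<open>D \<le> 1\<close>,
    and its minimality gives \<open>D \<le> 2 * (1/2) ^ k\<close>. Hence \<open>2 * d < D\<close>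
    puts \<open>d\<close> below \<open>(1/2) ^ k\<close>.\<close>
  define k where "k = (LEAST k. (1/2) ^ k < D)"
  have k: "(1/2) ^ k < D"
    unfolding k_def using k0 by (rule LeastI)
  then obtain i where i: "k = Suc i"
    using assms(2) by (cases k) auto
  have "\<not> (1/2) ^ i < D"
    using not_less_Least[of i "\<lambda>k. (1/2) ^ k < D"] i unfolding k_def by simp
  then have "d < (1/2) ^ k"
    using * i by simp
  then show False
    using le[of k] k by simp
qed

text \<open>The entourages may live on a larger space than \<open>A\<close>, so a function given
  only on a subset can be tested against the uniformity of the whole space.\<close>

definition uc_on :: "'a set \<Rightarrow> 'a rel set \<Rightarrow> ('a \<Rightarrow> real) \<Rightarrow> bool" where
  "uc_on A \<U> f \<longleftrightarrow> (\<forall>e>0. \<exists>E\<in>\<U>. \<forall>a\<in>A. \<forall>b\<in>A. (a, b) \<in> E \<longrightarrow> \<bar>f a - f b\<bar> < e)"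

text \<open>Two successive square roots suffice, since entourages contain the diagonal; intersecting
  with the converse gives symmetry.\<close>

lemma uniform_structure_cube_root:
  assumes "uniform_structure X \<U>" "E \<in> \<U>"
  obtains F where "F \<in> \<U>" "sym F" "F O F O F \<subseteq> E" "F O F \<subseteq> E" "F \<subseteq> E"
proof -
  note D = uniform_structureD[OF assms(1)]
  obtain G where G: "G \<in> \<U>" "G O G \<subseteq> E"
    using D(5)[OF assms(2)] by blast
  obtain H where H: "H \<in> \<U>" "H O H \<subseteq> G"
    using D(5)[OF G(1)] by blast
  have HX: "H \<subseteq> X \<times> X" "Id_on X \<subseteq> H" and GX: "G \<subseteq> X \<times> X" "Id_on X \<subseteq> G"
    using D(2,3) H G by auto
  have sub: "R \<subseteq> R O R" if "R \<subseteq> X \<times> X" "Id_on X \<subseteq> R" for R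
  proof
    fix p assume "p \<in> R"
    then show "p \<in> R O R"
      using that by (cases p) blast
  qed
  have "H \<subseteq> G" "G \<subseteq> E"
    using sub[OF HX] sub[OF GX] H(2) G(2) by auto
  then have 1: "H O H O H \<subseteq> E" "H O H \<subseteq> E" "H \<subseteq> E"
    using G(2) H(2) relcomp_mono[of H G "H O H" G] by auto
  show thesis
  proof (rule that[of "H \<inter> H\<inverse>"])
    show "H \<inter> H\<inverse> \<in> \<U>"
      using D(4,6) H(1) by blast
  qed (use 1 in \<open>auto simp: sym_def\<close>)
qed

text \<open>McShane's formula for the extension of a Lipschitz function, with respect to a pseudometric
  that dominates \<open>f\<close> on \<open>A\<close> and whose unit balls are finer than \<open>U\<close>.\<close>

lemma uniform_extension:
  assumes X: "uniform_structure X \<U>" and A: "A \<subseteq> X" "A \<noteq> {}"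
    and f: "uc_on A \<U> f" "\<And>a. a \<in> A \<Longrightarrow> 0 \<le> f a \<and> f a \<le> 1" and U: "U \<in> \<U>"
  obtains g where "uc_on X \<U> g" "\<forall>x. 0 \<le> g x \<and> g x \<le> 1" "\<forall>a\<in>A. g a = f a"
    and "\<forall>y\<in>X. \<forall>t\<le>1. g y < t \<longrightarrow> (\<exists>a\<in>A. f a < t \<and> (y, a) \<in> U)"
proof -
  note D = uniform_structureD[OF X]
  \<comment> \<open>The scale \<open>(1/2) ^ k\<close> ties the oscillation of \<open>f\<close> to
    the pseudometric, and \<open>E \<subseteq> U\<close> makes even the coarsest entourage of the
    sequence finer than \<open>U\<close>.\<close>
  define P where "P k E \<longleftrightarrow> E \<in> \<U> \<and> sym E \<and> E \<subseteq> U \<and>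
    (\<forall>a\<in>A. \<forall>b\<in>A. (a, b) \<in> E \<longrightarrow> \<bar>f a - f b\<bar> < (1/2) ^ k)" for k :: nat and E
  have ex: "\<exists>F. P k F \<and> F O F O F \<subseteq> E" if E: "E \<in> \<U>" for k E
  proof -
    obtain E' where E': "E' \<in> \<U>" "\<forall>a\<in>A. \<forall>b\<in>A. (a, b) \<in> E' \<longrightarrow> \<bar>f a - f b\<bar> < (1/2) ^ k"
      using f(1)[unfolded uc_on_def, rule_format, of "(1/2) ^ k"] by auto
    have "E \<inter> E' \<inter> U \<in> \<U>"
      using D(6) E E'(1) U by blast
    then obtain F
      where F: "F \<in> \<U>" "sym F" "F O F O F \<subseteq> E \<inter> E' \<inter> U" "F \<subseteq> E \<inter> E' \<inter> U"
      using uniform_structure_cube_root[OF X] by metis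
    then have "P k F" "F O F O F \<subseteq> E"
      unfolding P_def using E'(2) by auto
    then show ?thesis
      by blast
  qed
  have "\<exists>Us. \<forall>k. P (Suc k) (Us k) \<and> Us (Suc k) O Us (Suc k) O Us (Suc k) \<subseteq> Us k"
  proof (rule dependent_nat_choice)
    show "\<exists>E. P (Suc 0) E"
      using ex[OF U] by blast
    show "\<exists>F. P (Suc (Suc k)) F \<and> F O F O F \<subseteq> E" if "P (Suc k) E" for E k
      using ex that unfolding P_def[of "Suc k"] by blast
  qed
  then obtain Us where Us: "\<And>k. P (Suc k) (Us k)" "\<And>k. Us (Suc k) O Us (Suc k) O Us (Suc k) \<subseteq> Us k"
    by blast
  \<comment> \<open>The index is shifted so that \<open>V 0 = UNIV\<close>. The diagonal of the
    whole type is added because the entourages contain only that of \<open>X\<close>, while the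
    pseudometric lives on the type.\<close>
  define V where "V k = (case k of 0 \<Rightarrow> UNIV | Suc i \<Rightarrow> Us i \<union> Id)" for k
  have Us3: "Us (Suc k) \<subseteq> Us k" "Us (Suc k) O Us (Suc k) \<subseteq> Us k" for k
  proof -
    have *: "Us (Suc k) \<subseteq> X \<times> X" "Id_on X \<subseteq> Us (Suc k)"
      using Us(1)[of "Suc k"] D(2,3) unfolding P_def by blast+
    show "Us (Suc k) O Us (Suc k) \<subseteq> Us k"
    proof
      fix p assume "p \<in> Us (Suc k) O Us (Suc k)"
      then show "p \<in> Us k"
        using * Us(2)[of k] by (cases p) blast
    qed
    then show "Us (Suc k) \<subseteq> Us k"
      using * by blast
  qed
  have V0: "V 0 = UNIV" and VId: "Id \<subseteq> V k" for k
    unfolding V_def by (auto split: nat.split)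
  have Vsym: "sym (V k)" for k
    using Us(1) unfolding V_def P_def by (auto split: nat.split simp: sym_Un sym_Id)
  have V3: "V (Suc k) O V (Suc k) O V (Suc k) \<subseteq> V k" for k
  proof (cases k)
    case (Suc i)
    then show ?thesis
      using Us(2)[of i] Us3[of i] unfolding V_def by (simp add: O_assoc) blast
  qed (simp add: V_def)
  obtain d where psm: "pseudometric d" and dV: "\<forall>x y k. (x, y) \<in> V k \<longrightarrow> d x y \<le> (1/2) ^ k"
    "\<forall>x y k. d x y < (1/2) ^ k \<longrightarrow> (x, y) \<in> V k"
    by (rule frink_pseudometric[of V, OF V0 VId Vsym V3])
  have d: "0 \<le> d x y" "d x x = 0" "d x y = d y x" "d x z \<le> d x y + d y z"
    "(x, y) \<in> V k \<Longrightarrow> d x y \<le> (1/2) ^ k" "d x y < (1/2) ^ k \<Longrightarrow> (x, y) \<in> V k" for x y z k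
    using psm dV unfolding pseudometric_def by auto
  \<comment> \<open>On \<open>A\<close> the function is 2-Lipschitz for \<open>d\<close>: distance
    below \<open>(1/2) ^ k\<close> puts the pair in \<open>V k\<close>, where \<open>f\<close>
    oscillates by at most \<open>(1/2) ^ k\<close>. For \<open>k = 0\<close> this is the bound on
    the range of \<open>f\<close>.\<close>
  have fd: "f a - f b \<le> 2 * d b a" if ab: "a \<in> A" "b \<in> A" for a b
  proof (rule le_twice_of_dyadic[OF d(1)])
    show 1: "f a - f b \<le> 1"
      using f(2)[OF ab(1)] f(2)[OF ab(2)] by linarith
    show "f a - f b \<le> (1/2) ^ k" if "d b a < (1/2) ^ k" for k
    proof (cases k)
      case (Suc i)
      have "(b, a) \<in> Us i \<or> b = a"
        using d(6)[OF that] Suc by (auto simp: V_def)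
      moreover have "\<bar>f b - f a\<bar> < (1/2) ^ k" if "(b, a) \<in> Us i"
        using Us(1)[of i] ab that Suc unfolding P_def by blast
      moreover have "(0::real) < (1/2) ^ k"
        by simp
      ultimately show ?thesis
        by (auto simp: abs_less_iff)
    qed (use 1 in simp)
  qed
  define I where "I y = (INF a\<in>A. f a + 2 * d a y)" for y
  have bdd: "bdd_below ((\<lambda>a. f a + 2 * d a y) ` A)" for y
    using f(2) d(1) by (intro bdd_belowI[of _ 0]) (auto intro: add_nonneg_nonneg)
  have I_le: "I y \<le> f a + 2 * d a y" if "a \<in> A" for a y
    unfolding I_def by (rule cINF_lower[OF bdd that])
  have I_ge: "r \<le> I y" if "\<And>a. a \<in> A \<Longrightarrow> r \<le> f a + 2 * d a y" for r y
    unfolding I_def by (rule cINF_greatest[OF A(2) that])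
  \<comment> \<open>Truncation keeps the range bounded by 1 and, as \<open>f \<le> 1\<close>,
    changes nothing on \<open>A\<close>.\<close>
  define g where "g y = min 1 (I y)" for y
  have g01: "0 \<le> g y \<and> g y \<le> 1" for y
    unfolding g_def using f(2) d(1) by (auto intro!: I_ge add_nonneg_nonneg)
  have gA: "g a = f a" if a: "a \<in> A" for a
  proof -
    have "I a \<le> f a"
      using I_le[OF a, of a] d(2)[of a] by simp
    moreover have "f a \<le> I a"
      using fd[OF a] by (intro I_ge) (simp add: algebra_simps)
    ultimately show ?thesis
      using f(2)[OF a] unfolding g_def by simp
  qed
  have "I y \<le> I z + 2 * d y z" for y z
  proof -
    have "I y - 2 * d y z \<le> I z"
    proof (rule I_ge)
      fix a assume "a \<in> A"
      then show "I y - 2 * d y z \<le> f a + 2 * d a z"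
        using I_le[of a y] d(4)[of a y z] d(3)[of y z] by linarith
    qed
    then show ?thesis by simp
  qed
  then have lip: "\<bar>g y - g z\<bar> \<le> 2 * d y z" for y z
    unfolding g_def using d(3)[of y z] d(1)[of y z] by (smt (verit))
  have uc: "uc_on X \<U> g"
    unfolding uc_on_def
  proof (intro allI impI)
    fix e :: real assume "0 < e"
    then obtain k where k: "(1/2) ^ k < e"
      using real_arch_pow_inv[of e "1/2"] by auto
    have "\<bar>g a - g b\<bar> < e" if "(a, b) \<in> Us k" for a b
      using lip[of a b] d(5)[of a b "Suc k"] that k by (simp add: V_def)
    then show "\<exists>E\<in>\<U>. \<forall>a\<in>X. \<forall>b\<in>X. (a, b) \<in> E \<longrightarrow> \<bar>g a - g b\<bar> < e"
      using Us(1)[of k] unfolding P_def by blast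
  qed
  \<comment> \<open>An almost optimal \<open>a\<close> in the infimum satisfies
    \<open>2 * d a y < t \<le> 1\<close>, so the distance is below 1/2 and the pair lies in
    \<open>V 1\<close>, that is, in \<open>Us 0\<close> or on the diagonal.\<close>
  have near: "\<exists>a\<in>A. f a < t \<and> (y, a) \<in> U" if y: "y \<in> X" "g y < t" "t \<le> 1" for y t
  proof -
    have "I y < t"
      using y unfolding g_def by linarith
    then obtain a where a: "a \<in> A" "f a + 2 * d a y < t"
      using I_ge[of t y] by (meson not_le)
    have "f a < t" "d y a < (1/2) ^ 1"
      using a d(1)[of a y] d(3)[of a y] f(2)[OF a(1)] y(3) by auto
    moreover have "(y, a) \<in> Us 0 \<or> y = a"
      using d(6)[OF \<open>d y a < (1/2) ^ 1\<close>] by (auto simp: V_def)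
    then have "(y, a) \<in> U"
      using Us(1)[of 0] D(3)[OF U] y(1) unfolding P_def by blast
    ultimately show ?thesis
      using a(1) by blast
  qed
  then have "\<forall>y\<in>X. \<forall>t\<le>1. g y < t \<longrightarrow> (\<exists>a\<in>A. f a < t \<and> (y, a) \<in> U)"
    by blast
  then show thesis
    by (rule that[OF uc, rotated 2]) (simp_all add: g01 gA)
qed

section \<open>Interiors of balls and induced uniformities\<close>

lemma uniform_ball_nbhd:
  assumes X: "uniform_structure X \<U>" and "a \<in> X" "E \<in> \<U>"
  obtains G where "openin (uniform_topology X \<U>) G" "a \<in> G" "G \<subseteq> ent_ball X a E"
proof
  \<comment> \<open>An entourage ball need not be open. This set is its interior, and a square root
    of an entourage shows that it is open.\<close>
  let ?G = "{x \<in> X. \<exists>F\<in>\<U>. ent_ball X x F \<subseteq> ent_ball X a E}"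
  note D = uniform_structureD[OF X]
  have "\<exists>F\<in>\<U>. ent_ball X x F \<subseteq> ?G" if x: "x \<in> ?G" for x
  proof -
    obtain F where F: "F \<in> \<U>" "ent_ball X x F \<subseteq> ent_ball X a E"
      using x by blast
    obtain H where H: "H \<in> \<U>" "H O H \<subseteq> F"
      using D(5)[OF F(1)] by blast
    have "ent_ball X y H \<subseteq> ent_ball X x F" if "y \<in> ent_ball X x H" for y
      using that H(2) unfolding ent_ball_def by blast
    then have "ent_ball X x H \<subseteq> ?G"
      using F(2) H(1) unfolding ent_ball_def[of X x H] by blast
    then show ?thesis
      using H(1) by blast
  qed
  then show "openin (uniform_topology X \<U>) ?G"
    unfolding openin_uniform_topology[OF X] by blast
  show "a \<in> ?G"
    using assms by blast
  show "?G \<subseteq> ent_ball X a E"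
  proof
    fix x assume "x \<in> ?G"
    then obtain F where F: "x \<in> X" "F \<in> \<U>" "ent_ball X x F \<subseteq> ent_ball X a E"
      by blast
    then have "x \<in> ent_ball X x F"
      using D(3)[OF F(2)] unfolding ent_ball_def by blast
    then show "x \<in> ent_ball X a E"
      using F(3) by blast
  qed
qed

lemma uniform_structure_induced:
  assumes X: "uniform_structure X \<U>" and A: "A \<subseteq> X"
  shows "uniform_structure A (induced_uniformity A \<U>)"
proof -
  note D = uniform_structureD[OF X]
  let ?I = "induced_uniformity A \<U>"
  have I: "E \<in> ?I \<longleftrightarrow> (\<exists>F\<in>\<U>. E = F \<inter> A \<times> A)" for E
    unfolding induced_uniformity_def by blast
  have 1: "A \<times> A \<in> ?I"
    unfolding I using D(1) A by (intro bexI[of _ "X \<times> X"]) auto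
  have 2: "E \<subseteq> A \<times> A \<and> Id_on A \<subseteq> E \<and> E\<inverse> \<in> ?I \<and> (\<exists>F\<in>?I. F O F \<subseteq> E)" if E: "E \<in> ?I" for E
  proof -
    obtain F where F: "F \<in> \<U>" "E = F \<inter> A \<times> A"
      using E I by blast
    obtain H where H: "H \<in> \<U>" "H O H \<subseteq> F"
      using D(5)[OF F(1)] by blast
    have "E\<inverse> = F\<inverse> \<inter> A \<times> A"
      using F(2) by blast
    then have "E\<inverse> \<in> ?I"
      using D(4)[OF F(1)] I by blast
    moreover have "H \<inter> A \<times> A \<in> ?I" "(H \<inter> A \<times> A) O (H \<inter> A \<times> A) \<subseteq> E"
      using H F(2) I by blast+
    moreover have "Id_on A \<subseteq> E"
      using D(3)[OF F(1)] A F(2) by blast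
    ultimately show ?thesis
      using F(2) by blast
  qed
  have 3: "E \<inter> F \<in> ?I" if EF: "E \<in> ?I" "F \<in> ?I" for E F
  proof -
    obtain E' F' where *: "E' \<in> \<U>" "F' \<in> \<U>" "E = E' \<inter> A \<times> A" "F = F' \<inter> A \<times> A"
      using EF unfolding induced_uniformity_def by blast
    then have "E \<inter> F = (E' \<inter> F') \<inter> A \<times> A"
      by blast
    then show ?thesis
      using D(6)[OF *(1,2)] unfolding I by blast
  qed
  have 4: "F \<in> ?I" if EF: "E \<in> ?I" "E \<subseteq> F" "F \<subseteq> A \<times> A" for E F
  proof -
    obtain E' where *: "E' \<in> \<U>" "E = E' \<inter> A \<times> A"
      using EF(1) unfolding induced_uniformity_def by blast
    \<comment> \<open>Adding \<open>F\<close> to \<open>E'\<close> gives an entourage of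
      \<open>X\<close> whose trace on \<open>A\<close> is exactly \<open>F\<close>.\<close>
    have "E' \<union> F \<subseteq> X \<times> X"
      using D(2)[OF *(1)] EF(3) A by blast
    then have "E' \<union> F \<in> \<U>"
      using D(7)[OF *(1), of "E' \<union> F"] by blast
    moreover have "F = (E' \<union> F) \<inter> A \<times> A"
      using EF * by blast
    ultimately show ?thesis
      unfolding I by blast
  qed
  show ?thesis
    unfolding uniform_structure_def using 1 2 3 4 by (intro conjI ballI allI impI) simp_all
qed

lemma uniform_topology_induced:
  assumes X: "uniform_structure X \<U>" and A: "A \<subseteq> X"
  shows "uniform_topology A (induced_uniformity A \<U>) = subtopology (uniform_topology X \<U>) A"
proof -
  have ball: "ent_ball A a (E \<inter> A \<times> A) = ent_ball X a E \<inter> A" if "a \<in> A" for a E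
    using that A unfolding ent_ball_def by blast
  have "openin (uniform_topology A (induced_uniformity A \<U>)) G \<longleftrightarrow>
      openin (subtopology (uniform_topology X \<U>) A) G" for G
  proof
    assume "openin (uniform_topology A (induced_uniformity A \<U>)) G"
    then have GA: "G \<subseteq> A" and "\<forall>a\<in>G. \<exists>E\<in>\<U>. ent_ball A a (E \<inter> A \<times> A) \<subseteq> G"
      unfolding openin_uniform_topology[OF uniform_structure_induced[OF X A]]
      unfolding induced_uniformity_def
      by simp_all
    then have G: "G \<subseteq> A" "\<forall>a\<in>G. \<exists>E\<in>\<U>. ent_ball X a E \<inter> A \<subseteq> G"
      using ball by (simp_all add: subset_iff)
    \<comment> \<open>The largest open set with trace inside \<open>G\<close>; a union of balls
      would not do, since balls need not be open.\<close>
    let ?H = "\<Union>{H. openin (uniform_topology X \<U>) H \<and> H \<inter> A \<subseteq> G}"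
    have "G \<subseteq> ?H \<inter> A"
    proof
      fix a assume a: "a \<in> G"
      then obtain E where "E \<in> \<U>" "ent_ball X a E \<inter> A \<subseteq> G"
        using G by blast
      moreover from this obtain H where "openin (uniform_topology X \<U>) H" "a \<in> H" "H \<subseteq> ent_ball X a E"
        using uniform_ball_nbhd[OF X, of a E] a G(1) A by blast
      ultimately show "a \<in> ?H \<inter> A"
        using a G(1) by blast
    qed
    then have "G = ?H \<inter> A"
      by blast
    moreover have "openin (uniform_topology X \<U>) ?H"
      by (rule openin_Union) blast
    ultimately show "openin (subtopology (uniform_topology X \<U>) A) G"
      unfolding openin_subtopology by blast
  next
    assume "openin (subtopology (uniform_topology X \<U>) A) G"
    then obtain H where H: "G = H \<inter> A" "\<forall>a\<in>H. \<exists>E\<in>\<U>. ent_ball X a E \<subseteq> H"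
      unfolding openin_subtopology openin_uniform_topology[OF X] by blast
    show "openin (uniform_topology A (induced_uniformity A \<U>)) G"
      unfolding openin_uniform_topology[OF uniform_structure_induced[OF X A]]
      unfolding induced_uniformity_def
    proof (intro conjI ballI)
      show "G \<subseteq> A"
        using H by blast
      fix a assume a: "a \<in> G"
      then obtain E where "E \<in> \<U>" "ent_ball X a E \<subseteq> H"
        using H by blast
      then show "\<exists>E\<in>(\<lambda>E. E \<inter> A \<times> A) ` \<U>. ent_ball A a E \<subseteq> G"
        using ball[of a E] a H(1) by blast
    qed
  qed
  then show ?thesis
    by (simp add: topology_eq)
qed

section \<open>Charts of complemented sets\<close>

text \<open>A common form of both kinds of complementedness: the global kind has
  \<open>V = topspace C\<close> and \<open>N = X\<close>. Conditions (1) and (2) are stated with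
  entourages of \<open>X\<close> instead of \<open>N\<close> and with open sets of \<open>C\<close>,
  so that charts at successive stages can be combined directly.\<close>

definition complement_chart :: "'a set \<Rightarrow> 'a rel set \<Rightarrow> 'a set \<Rightarrow> 'c topology \<Rightarrow> 'c \<Rightarrow>
    'c set \<Rightarrow> 'a set \<Rightarrow> ('a \<times> 'c \<Rightarrow> 'a) \<Rightarrow> bool" where
  "complement_chart X \<U> A C c V N \<gamma> \<longleftrightarrow>
     openin C V \<and> c \<in> V \<and> openin (uniform_topology X \<U>) N \<and>
     homeomorphic_map (prod_topology (subtopology (uniform_topology X \<U>) A) (subtopology C V))
       (subtopology (uniform_topology X \<U>) N) \<gamma> \<and>
     (\<forall>W. openin C W \<and> c \<in> W \<longrightarrow>
        (\<exists>E\<in>\<U>. \<forall>a\<in>A. \<forall>y\<in>X. (y, a) \<in> E \<longrightarrow> y \<in> \<gamma> ` (A \<times> (W \<inter> V)))) \<and>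
     (\<forall>E\<in>\<U>. \<exists>W. openin C W \<and> c \<in> W \<and> W \<subseteq> V \<and> (\<forall>a\<in>A. \<forall>w\<in>W. (\<gamma> (a, w), a) \<in> E))"

lemma complement_chart_of_complemented:
  assumes X: "uniform_structure X \<U>" and V: "openin C V" "c \<in> V"
    and N: "openin (uniform_topology X \<U>) N" "uniform_neighborhood X \<U> A N"
    and compl: "complemented (subtopology C V) c N (induced_uniformity N \<U>) A"
  obtains \<gamma> where "complement_chart X \<U> A C c V N \<gamma>"
proof -
  note D = uniform_structureD[OF X]
  have NX: "N \<subseteq> X" and "\<exists>E\<in>\<U>. ent_nbhd X A E \<subseteq> N"
    using N(2) unfolding uniform_neighborhood_def by blast+
  then obtain E1 where E1: "E1 \<in> \<U>" "ent_nbhd X A E1 \<subseteq> N"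
    by blast
  have top: "uniform_topology N (induced_uniformity N \<U>) = subtopology (uniform_topology X \<U>) N"
    by (rule uniform_topology_induced[OF X NX])
  obtain \<gamma> where AN: "A \<subseteq> N" and homeo: "homeomorphic_map
      (prod_topology (subtopology (subtopology (uniform_topology X \<U>) N) A) (subtopology C V))
      (subtopology (uniform_topology X \<U>) N) \<gamma>"
    and 1: "\<And>W. pt_neighborhood (subtopology C V) c W \<Longrightarrow>
      \<exists>E\<in>induced_uniformity N \<U>. ent_nbhd N A E \<subseteq> \<gamma> ` (A \<times> W)"
    and 2: "\<And>E. E \<in> induced_uniformity N \<U> \<Longrightarrow> \<exists>W. pt_neighborhood (subtopology C V) c W \<and>
      (\<forall>a\<in>A. \<gamma> ` ({a} \<times> W) \<subseteq> ent_ball N a E)"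
    using compl unfolding complemented_def top by blast
  have "subtopology (subtopology (uniform_topology X \<U>) N) A = subtopology (uniform_topology X \<U>) A"
    using AN by (simp add: subtopology_subtopology inf.absorb2)
  note homeo = homeo[unfolded this]
  have 1: "\<exists>E\<in>\<U>. \<forall>a\<in>A. \<forall>y\<in>X. (y, a) \<in> E \<longrightarrow> y \<in> \<gamma> ` (A \<times> (W \<inter> V))" if W: "openin C W" "c \<in> W" for W
  proof -
    have "openin (subtopology C V) (W \<inter> V)"
      using W(1) by (auto simp: openin_subtopology)
    moreover from this have "W \<inter> V \<subseteq> topspace (subtopology C V)"
      by (rule openin_subset)
    ultimately have "pt_neighborhood (subtopology C V) c (W \<inter> V)"
      unfolding pt_neighborhood_def using W(2) V(2) by blast
    from 1[OF this] obtain E0 where E0: "E0 \<in> \<U>" "ent_nbhd N A (E0 \<inter> N \<times> N) \<subseteq> \<gamma> ` (A \<times> (W \<inter> V))"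
      unfolding induced_uniformity_def by blast
    show ?thesis
    proof (intro bexI ballI impI)
      \<comment> \<open>\<open>E1\<close> forces a point near \<open>A\<close> into
        \<open>N\<close>, after which the trace of \<open>E0\<close> on \<open>N\<close>
        applies.\<close>
      show "E0 \<inter> E1 \<in> \<U>"
        using D(6) E0(1) E1(1) by blast
      fix a y assume a: "a \<in> A" "y \<in> X" "(y, a) \<in> E0 \<inter> E1"
      then have "y \<in> ent_nbhd X A E1"
        unfolding ent_nbhd_def ent_ball_def by blast
      then have "y \<in> N"
        using E1(2) by blast
      then have "y \<in> ent_nbhd N A (E0 \<inter> N \<times> N)"
        using a AN unfolding ent_nbhd_def ent_ball_def by blast
      then show "y \<in> \<gamma> ` (A \<times> (W \<inter> V))"
        using E0(2) by blast
    qed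
  qed
  have 2: "\<exists>W. openin C W \<and> c \<in> W \<and> W \<subseteq> V \<and> (\<forall>a\<in>A. \<forall>w\<in>W. (\<gamma> (a, w), a) \<in> E)" if E: "E \<in> \<U>" for E
  proof -
    have "E \<inter> N \<times> N \<in> induced_uniformity N \<U>"
      using E unfolding induced_uniformity_def by blast
    from 2[OF this] obtain W where "pt_neighborhood (subtopology C V) c W"
      and W: "\<forall>a\<in>A. \<gamma> ` ({a} \<times> W) \<subseteq> ent_ball N a (E \<inter> N \<times> N)"
      by blast
    then obtain G where G: "openin (subtopology C V) G" "c \<in> G" "G \<subseteq> W"
      unfolding pt_neighborhood_def by blast
    then have "openin C G" "G \<subseteq> V"
      using V(1) openin_trans_full openin_subset[OF G(1)] by fastforce+
    moreover have "\<forall>a\<in>A. \<forall>w\<in>G. (\<gamma> (a, w), a) \<in> E"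
      using W G(3) unfolding ent_ball_def by blast
    ultimately show ?thesis
      using G(2) by blast
  qed
  have "complement_chart X \<U> A C c V N \<gamma>"
    unfolding complement_chart_def using V N(1) homeo 1 2 by (intro conjI allI impI ballI) simp_all
  then show thesis
    by (rule that)
qed

text \<open>By condition (2) the pair \<open>(\<gamma> (a, c), a)\<close> lies in every entourage,
  and the uniformity is Hausdorff.\<close>

lemma complement_chart_base_point:
  assumes X: "hausdorff_uniform_structure X \<U>" and "complement_chart X \<U> A C c V N \<gamma>" "a \<in> A"
  shows "\<gamma> (a, c) = a"
proof -
  have "(\<gamma> (a, c), a) \<in> E" if "E \<in> \<U>" for E
    using assms(2,3) that unfolding complement_chart_def by meson
  then have "(\<gamma> (a, c), a) \<in> \<Inter>\<U>"
    by blast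
  then show ?thesis
    using X unfolding hausdorff_uniform_structure_def by auto
qed

text \<open>By condition (1) a point \<open>y\<close> close to \<open>p\<close> has the form
  \<open>\<gamma> (a, w)\<close> with \<open>w\<close> as close to \<open>c\<close> as desired. By
  condition (2) \<open>a\<close> is then close to \<open>y\<close>, hence to \<open>p\<close>, so
  \<open>a\<close> lies in \<open>Q\<close>. Thus a set lying uniformly inside \<open>Q\<close> lies
  uniformly inside the chart image of a box over \<open>Q\<close>.\<close>

lemma complement_chart_uniform_interior:
  assumes X: "uniform_structure X \<U>" and chart: "complement_chart X \<U> A C c V N \<gamma>"
    and AX: "A \<subseteq> X" and P: "P \<subseteq> A"
    and E: "E \<in> \<U>" "\<And>p y. p \<in> P \<Longrightarrow> y \<in> A \<Longrightarrow> (y, p) \<in> E \<Longrightarrow> y \<in> Q"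
    and W: "openin C W" "c \<in> W"
  obtains E' where "E' \<in> \<U>" "\<forall>p\<in>P. \<forall>y\<in>X. (y, p) \<in> E' \<longrightarrow> y \<in> \<gamma> ` (Q \<times> (W \<inter> V))"
proof -
  note D = uniform_structureD[OF X]
  obtain F where F: "F \<in> \<U>" "sym F" "F O F \<subseteq> E"
    using uniform_structure_cube_root[OF X E(1)] by metis
  have "\<exists>W. openin C W \<and> c \<in> W \<and> W \<subseteq> V \<and> (\<forall>a\<in>A. \<forall>w\<in>W. (\<gamma> (a, w), a) \<in> F)"
    using chart F(1) unfolding complement_chart_def by blast
  then obtain W' where W': "openin C W'" "c \<in> W'" "\<forall>a\<in>A. \<forall>w\<in>W'. (\<gamma> (a, w), a) \<in> F"
    by blast
  have "openin C (W \<inter> W')" "c \<in> W \<inter> W'"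
    using W W' by auto
  then have "\<exists>E\<in>\<U>. \<forall>a\<in>A. \<forall>y\<in>X. (y, a) \<in> E \<longrightarrow> y \<in> \<gamma> ` (A \<times> ((W \<inter> W') \<inter> V))"
    using chart unfolding complement_chart_def by blast
  then obtain G where G: "G \<in> \<U>" "\<forall>a\<in>A. \<forall>y\<in>X. (y, a) \<in> G \<longrightarrow> y \<in> \<gamma> ` (A \<times> ((W \<inter> W') \<inter> V))"
    by blast
  show thesis
  proof (rule that[of "F \<inter> G"])
    show "F \<inter> G \<in> \<U>"
      using D(6) F(1) G(1) by blast
    show "\<forall>p\<in>P. \<forall>y\<in>X. (y, p) \<in> F \<inter> G \<longrightarrow> y \<in> \<gamma> ` (Q \<times> (W \<inter> V))"
    proof (intro ballI impI)
      fix p y assume py: "p \<in> P" "y \<in> X" "(y, p) \<in> F \<inter> G"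
      then have "y \<in> \<gamma> ` (A \<times> ((W \<inter> W') \<inter> V))"
        using G(2) P by blast
      then obtain a w where aw: "a \<in> A" "w \<in> W" "w \<in> W'" "w \<in> V" "y = \<gamma> (a, w)"
        by blast
      then have "(a, y) \<in> F"
        using W'(3) F(2) by (simp add: symD)
      then have "(a, p) \<in> E"
        using py(3) F(3) by blast
      then have "a \<in> Q"
        using E(2) py(1) aw(1) by blast
      then show "y \<in> \<gamma> ` (Q \<times> (W \<inter> V))"
        using aw by blast
    qed
  qed
qed

section \<open>Neighbourhoods in the uniform direct limit\<close>

locale tower =
  fixes X :: "nat \<Rightarrow> 'a set" and \<U> :: "nat \<Rightarrow> 'a rel set"
  assumes tower: "uniform_tower X \<U>"
begin

abbreviation limit_carrier :: "'a set" ("Y") where "Y \<equiv> \<Union>n. X n"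

abbreviation limit_uniformity :: "'a rel set" ("\<W>") where "\<W> \<equiv> direct_limit_uniformity X \<U>"

abbreviation stage_topology :: "nat \<Rightarrow> 'a topology" ("T") where "T n \<equiv> uniform_topology (X n) (\<U> n)"

section \<open>Passage between the stages and the limit\<close>

lemma hausdorff: "hausdorff_uniform_structure (X n) (\<U> n)"
  using tower unfolding uniform_tower_def by blast

lemma unif: "uniform_structure (X n) (\<U> n)"
  using hausdorff unfolding hausdorff_uniform_structure_def by blast

lemma X_mono: "m \<le> n \<Longrightarrow> X m \<subseteq> X n"
proof (rule lift_Suc_mono_le)
  show "X n \<subseteq> X (Suc n)" for n
    using tower unfolding uniform_tower_def by blast
qed

lemma uniformity_stage:
  assumes "m \<le> n"
  shows "\<U> m = induced_uniformity (X m) (\<U> n)"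
  using assms
proof (induction rule: dec_induct)
  case base
  have "E \<inter> X m \<times> X m = E" if "E \<in> \<U> m" for E
    using uniform_structureD(2)[OF unif that] by blast
  then show ?case
    unfolding induced_uniformity_def by simp
next
  case (step n)
  have "\<U> n = induced_uniformity (X n) (\<U> (Suc n))"
    using tower unfolding uniform_tower_def by blast
  moreover have "(X n \<times> X n) \<inter> (X m \<times> X m) = X m \<times> X m"
    using X_mono[OF step.hyps(1)] by blast
  ultimately have "induced_uniformity (X m) (\<U> n) = induced_uniformity (X m) (\<U> (Suc n))"
    unfolding induced_uniformity_def by (auto simp: image_image Int_assoc)
  then show ?case
    using step.IH by simp
qed

lemma stage_subtopology: "m \<le> n \<Longrightarrow> T m = subtopology (T n) (X m)"
  using uniform_topology_induced[OF unif X_mono, of m n] uniformity_stage by metis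

lemma limit_unif: "uniform_structure Y \<W>"
  by (rule direct_limit_uniformity_greatest[OF tower])

lemma limit_entourage: "E \<in> \<W> \<Longrightarrow> E \<inter> X n \<times> X n \<in> \<U> n"
proof -
  assume "E \<in> \<W>"
  then have "{(x, y) \<in> X n \<times> X n. (x, y) \<in> E} \<in> \<U> n"
    using direct_limit_uniformity_greatest(2)[OF tower]
    unfolding inclusions_uniformly_continuous_def uniformly_continuous_map_def by simp
  moreover have "{(x, y) \<in> X n \<times> X n. (x, y) \<in> E} = E \<inter> X n \<times> X n"
    by blast
  ultimately show ?thesis
    by simp
qed

lemma openin_limit:
  "openin (uniform_direct_limit X \<U>) G \<longleftrightarrow> G \<subseteq> Y \<and> (\<forall>a\<in>G. \<exists>E\<in>\<W>. ent_ball Y a E \<subseteq> G)"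
  unfolding uniform_direct_limit_def by (rule openin_uniform_topology[OF limit_unif])

lemma topspace_limit: "topspace (uniform_direct_limit X \<U>) = Y"
  unfolding uniform_direct_limit_def by (rule topspace_uniform_topology[OF limit_unif])

lemma topspace_stage: "topspace (T n) = X n"
  by (rule topspace_uniform_topology[OF unif])

lemma uc_on_stage:
  assumes "m \<le> n" "uc_on (X m) (\<U> m) f"
  shows "uc_on (X m) (\<U> n) f"
  unfolding uc_on_def
proof (intro allI impI)
  fix e :: real assume "0 < e"
  then obtain E where E: "E \<in> \<U> m" "\<forall>a\<in>X m. \<forall>b\<in>X m. (a, b) \<in> E \<longrightarrow> \<bar>f a - f b\<bar> < e"
    using assms(2) unfolding uc_on_def by blast
  then obtain F where "F \<in> \<U> n" "E = F \<inter> X m \<times> X m"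
    using uniformity_stage[OF assms(1)] unfolding induced_uniformity_def by blast
  then show "\<exists>E\<in>\<U> n. \<forall>a\<in>X m. \<forall>b\<in>X m. (a, b) \<in> E \<longrightarrow> \<bar>f a - f b\<bar> < e"
    using E(2) by blast
qed

lemma uc_on_restrict:
  assumes "m \<le> n" "uc_on (X n) (\<U> n) f"
  shows "uc_on (X m) (\<U> m) f"
  unfolding uc_on_def
proof (intro allI impI)
  fix e :: real assume "0 < e"
  then obtain E where E: "E \<in> \<U> n" "\<forall>a\<in>X n. \<forall>b\<in>X n. (a, b) \<in> E \<longrightarrow> \<bar>f a - f b\<bar> < e"
    using assms(2) unfolding uc_on_def by blast
  then have "E \<inter> X m \<times> X m \<in> \<U> m"
    using uniformity_stage[OF assms(1)] unfolding induced_uniformity_def by blast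
  then show "\<exists>E\<in>\<U> m. \<forall>a\<in>X m. \<forall>b\<in>X m. (a, b) \<in> E \<longrightarrow> \<bar>f a - f b\<bar> < e"
    using E(2) X_mono[OF assms(1)] by blast
qed

text \<open>This is where the maximality of the limit uniformity is used: the relations \<bar>F y -
  F z\<bar> < e generate a uniformity on \<open>Y\<close> that makes all inclusions uniformly
  continuous, so they are entourages of the limit.\<close>

lemma openin_limit_sublevel:
  fixes F :: "'a \<Rightarrow> real"
  assumes "\<And>n. uc_on (X n) (\<U> n) F"
  shows "openin (uniform_direct_limit X \<U>) {y \<in> Y. F y < r}"
proof -
  define B where "B e = {(y, z) \<in> Y \<times> Y. \<bar>F y - F z\<bar> < e}" for e
  define \<V> where "\<V> = {E. E \<subseteq> Y \<times> Y \<and> (\<exists>e>0. B e \<subseteq> E)}"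
  have B_mem: "B e \<in> \<V>" if "0 < e" for e
    using that unfolding \<V>_def B_def by blast
  have "uniform_structure Y \<V>"
    unfolding uniform_structure_def
  proof (intro conjI ballI allI impI)
    show "Y \<times> Y \<in> \<V>"
      unfolding \<V>_def B_def using zero_less_one by blast
  next
    fix E assume "E \<in> \<V>"
    then obtain e where e: "E \<subseteq> Y \<times> Y" "0 < e" "B e \<subseteq> E"
      unfolding \<V>_def by blast
    show "E \<subseteq> Y \<times> Y"
      by (fact e)
    have "Id_on Y \<subseteq> B e"
      using e(2) unfolding B_def by auto
    then show "Id_on Y \<subseteq> E"
      using e(3) by blast
    have "B e \<subseteq> E\<inverse>"
    proof
      fix p assume "p \<in> B e"
      then have "(snd p, fst p) \<in> B e"
        unfolding B_def by (auto simp: abs_minus_commute)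
      then show "p \<in> E\<inverse>"
        using e(3) by (cases p) auto
    qed
    moreover have "E\<inverse> \<subseteq> Y \<times> Y"
      using e(1) by blast
    ultimately show "E\<inverse> \<in> \<V>"
      using e(2) unfolding \<V>_def by blast
    have "\<bar>F y - F z\<bar> < e" if "\<bar>F y - F u\<bar> < e / 2" "\<bar>F u - F z\<bar> < e / 2" for y u z
      using that by linarith
    then have "B (e / 2) O B (e / 2) \<subseteq> B e"
      unfolding B_def by blast
    then show "\<exists>F\<in>\<V>. F O F \<subseteq> E"
      using B_mem[of "e / 2"] e by (meson half_gt_zero order_trans)
    show "F \<in> \<V>" if "E \<subseteq> F \<and> F \<subseteq> Y \<times> Y" for F
      using that e unfolding \<V>_def by blast
  next
    fix E F assume "E \<in> \<V>" "F \<in> \<V>"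
    then obtain e f where ef: "0 < e" "B e \<subseteq> E" "0 < f" "B f \<subseteq> F" "E \<subseteq> Y \<times> Y"
      unfolding \<V>_def by blast
    have "B (min e f) \<subseteq> B e \<inter> B f"
      unfolding B_def by auto
    moreover have "0 < min e f"
      using ef by simp
    ultimately show "E \<inter> F \<in> \<V>"
      using ef unfolding \<V>_def by blast
  qed
  moreover have "inclusions_uniformly_continuous X \<U> \<V>"
    unfolding inclusions_uniformly_continuous_def uniformly_continuous_map_def
  proof (intro allI conjI ballI)
    fix n
    show "(\<lambda>x. x) \<in> X n \<rightarrow> Y"
      by blast
    fix E assume "E \<in> \<V>"
    then obtain e where e: "0 < e" "B e \<subseteq> E"
      unfolding \<V>_def by blast
    then obtain G where G: "G \<in> \<U> n" "\<forall>a\<in>X n. \<forall>b\<in>X n. (a, b) \<in> G \<longrightarrow> \<bar>F a - F b\<bar> < e"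
      using assms unfolding uc_on_def by blast
    have GX: "G \<subseteq> X n \<times> X n"
      using uniform_structureD(2)[OF unif G(1)] .
    then have "G \<subseteq> B e"
      using G(2) unfolding B_def by blast
    then have "G \<subseteq> {(x, y) \<in> X n \<times> X n. (x, y) \<in> E}"
      using GX e(2) by blast
    then show "{(x, y) \<in> X n \<times> X n. (x, y) \<in> E} \<in> \<U> n"
      by (rule uniform_structureD(7)[OF unif G(1)]) blast
  qed
  ultimately have "\<V> \<subseteq> \<W>"
    by (rule direct_limit_uniformity_greatest(3)[OF tower])
  then have B_lim: "B e \<in> \<W>" if "0 < e" for e
    using B_mem[OF that] by blast
  show ?thesis
    unfolding openin_limit
  proof (intro conjI ballI)
    fix a assume a: "a \<in> {y \<in> Y. F y < r}"
    then have "ent_ball Y a (B (r - F a)) \<subseteq> {y \<in> Y. F y < r}"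
      unfolding ent_ball_def B_def by auto
    then show "\<exists>E\<in>\<W>. ent_ball Y a E \<subseteq> {y \<in> Y. F y < r}"
      using B_lim[of "r - F a"] a by auto
  qed blast
qed

text \<open>A uniformly continuous function on \<open>Y\<close> that is small only on the union of the \<open>Q n\<close> is
  built stage by stage: at each stage it is extended from \<open>X n\<close> to \<open>X (Suc n)\<close>, while the level
  below which it forces membership in \<open>Q n\<close> drops from 1 towards 1/2.\<close>

lemma limit_neighbourhood:
  assumes chart: "\<And>n. k \<le> n \<Longrightarrow>
      complement_chart (X (Suc n)) (\<U> (Suc n)) (X n) (C n) (c n) (V n) (N n) (\<gamma> n)"
    and W: "\<And>n. k \<le> n \<Longrightarrow> openin (C n) (W n)" "\<And>n. k \<le> n \<Longrightarrow> c n \<in> W n"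
    and Q: "openin (T k) (Q k)" "x \<in> Q k" "\<And>n. k \<le> n \<Longrightarrow> \<gamma> n ` (Q n \<times> (W n \<inter> V n)) \<subseteq> Q (Suc n)"
  obtains G where "openin (uniform_direct_limit X \<U>) G" "x \<in> G" "G \<subseteq> (\<Union>n\<in>{k..}. Q n)"
proof -
  \<comment> \<open>All levels stay above 1/2, so a final value below 1/2 is below the level of
    every stage; the positive gap between consecutive levels is used up in the extension
    step.\<close>
  define t :: "nat \<Rightarrow> real" where "t j = 1/2 + (1/2) ^ Suc j" for j
  have t: "t 0 = 1" "t j \<le> 1" "1/2 < t j" "t (Suc j) < t j" for j
    unfolding t_def using power_le_one[of "1/2::real" j] by auto
  define P where "P j f \<longleftrightarrow> uc_on (X (k + j)) (\<U> (k + j)) f \<and> (\<forall>y. 0 \<le> f y \<and> f y \<le> 1) \<and> f x = 0 \<and>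
    (\<forall>y\<in>X (k + j). f y < t j \<longrightarrow> y \<in> Q (k + j))" for j and f :: "'a \<Rightarrow> real"
  have xk: "x \<in> X k"
    using Q(1,2) openin_subset[OF Q(1)] topspace_stage by blast
  have "\<exists>f. \<forall>j. P j (f j) \<and> (\<forall>y\<in>X (k + j). f (Suc j) y = f j y)"
  proof (rule dependent_nat_choice)
    obtain E where E: "E \<in> \<U> k" "ent_ball (X k) x E \<subseteq> Q k"
      using Q(1,2) unfolding openin_uniform_topology[OF unif] by blast
    \<comment> \<open>The first function extends the constant 0 from \<open>{x}\<close>: a value
      below 1 then forces \<open>E\<close>-closeness to \<open>x\<close>, hence membership in
      \<open>Q k\<close>.\<close>
    have "uc_on {x} (\<U> k) (\<lambda>_. 0)"
      using E(1) unfolding uc_on_def by auto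
    then obtain g where g: "uc_on (X k) (\<U> k) g" "\<forall>x. 0 \<le> g x \<and> g x \<le> 1" "\<forall>a\<in>{x}. g a = 0"
      "\<forall>y\<in>X k. \<forall>t\<le>1. g y < t \<longrightarrow> (\<exists>a\<in>{x}. 0 < t \<and> (y, a) \<in> E)"
      using uniform_extension[OF unif, of "{x}" k "\<lambda>_. 0" E] xk E(1) by auto
    have "y \<in> Q k" if "y \<in> X k" "g y < 1" for y
      using g(4) that E(2) unfolding ent_ball_def by auto
    then have "P 0 g"
      unfolding P_def using g t(1) by auto
    then show "\<exists>f. P 0 f"
      by blast
  next
    fix f j assume "P j f"
    define n where "n = k + j"
    have f: "uc_on (X n) (\<U> n) f" "\<forall>y. 0 \<le> f y \<and> f y \<le> 1" "f x = 0"
      "\<And>y. y \<in> X n \<Longrightarrow> f y < t j \<Longrightarrow> y \<in> Q n"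
      using \<open>P j f\<close> unfolding P_def n_def by auto
    have kn: "k \<le> n"
      unfolding n_def by simp
    have XX: "X n \<subseteq> X (Suc n)"
      by (rule X_mono) simp
    have uc: "uc_on (X n) (\<U> (Suc n)) f"
      by (rule uc_on_stage[OF _ f(1)]) simp
    have "0 < t j - t (Suc j)"
      using t(4) by simp
    then obtain E where E: "E \<in> \<U> (Suc n)"
      "\<forall>a\<in>X n. \<forall>b\<in>X n. (a, b) \<in> E \<longrightarrow> \<bar>f a - f b\<bar> < t j - t (Suc j)"
      using uc unfolding uc_on_def by blast
    \<comment> \<open>Along \<open>E\<close> the function changes by less than the gap between the
      two levels, so the lower sublevel set lies uniformly inside \<open>Q n\<close>.\<close>
    have near: "y \<in> Q n" if "p \<in> {y \<in> X n. f y < t (Suc j)}" "y \<in> X n" "(y, p) \<in> E" for p y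
    proof (rule f(4)[OF that(2)])
      have "\<bar>f y - f p\<bar> < t j - t (Suc j)" "f p < t (Suc j)"
        using E(2) that by blast+
      then show "f y < t j"
        by linarith
    qed
    have sub: "{y \<in> X n. f y < t (Suc j)} \<subseteq> X n"
      by blast
    obtain E' where E': "E' \<in> \<U> (Suc n)" "\<forall>p\<in>{y \<in> X n. f y < t (Suc j)}. \<forall>y\<in>X (Suc n).
        (y, p) \<in> E' \<longrightarrow> y \<in> \<gamma> n ` (Q n \<times> (W n \<inter> V n))"
      by (rule complement_chart_uniform_interior[OF unif chart[OF kn] XX sub E(1) near W(1)[OF kn] W(2)[OF kn]])
    \<comment> \<open>Extending with \<open>E'\<close> as the prescribed closeness makes every point
      with \<open>g y < t (Suc j)\<close> an \<open>E'\<close>-neighbour of the lower sublevel set,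
      hence a point of the chart image.\<close>
    obtain g where g: "uc_on (X (Suc n)) (\<U> (Suc n)) g" "\<forall>x. 0 \<le> g x \<and> g x \<le> 1" "\<forall>a\<in>X n. g a = f a"
      "\<forall>y\<in>X (Suc n). \<forall>t\<le>1. g y < t \<longrightarrow> (\<exists>a\<in>X n. f a < t \<and> (y, a) \<in> E')"
      using uniform_extension[OF unif XX _ uc _ E'(1)] xk X_mono[OF kn] f(2) by blast
    have "y \<in> Q (Suc n)" if y: "y \<in> X (Suc n)" "g y < t (Suc j)" for y
    proof -
      obtain a where "a \<in> X n" "f a < t (Suc j)" "(y, a) \<in> E'"
        using g(4) y t(2) by blast
      then have "y \<in> \<gamma> n ` (Q n \<times> (W n \<inter> V n))"
        using E'(2) y(1) by blast
      then show ?thesis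
        using Q(3)[OF kn] by blast
    qed
    moreover have "g x = 0"
      using g(3) f(3) xk X_mono[OF kn] by auto
    ultimately have "P (Suc j) g \<and> (\<forall>y\<in>X (k + j). g y = f y)"
      unfolding P_def using g by (simp add: n_def)
    then show "\<exists>g. P (Suc j) g \<and> (\<forall>y\<in>X (k + j). g y = f y)"
      by blast
  qed
  then obtain f where f: "\<And>j. P j (f j)" and ext: "\<And>j y. y \<in> X (k + j) \<Longrightarrow> f (Suc j) y = f j y"
    by blast
  \<comment> \<open>Later functions extend earlier ones, so any stage containing \<open>y\<close>
    gives the same value.\<close>
  define F where "F y = f (LEAST j. y \<in> X (k + j)) y" for y
  have F: "F y = f j y" if y: "y \<in> X (k + j)" for y j
  proof -
    define i where "i = (LEAST j. y \<in> X (k + j))"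
    have i: "y \<in> X (k + i)" "i \<le> j"
      unfolding i_def using y by (auto intro: LeastI Least_le)
    have "f j y = f i y"
      using i(2)
    proof (induction rule: dec_induct)
      case (step j)
      then show ?case
        using ext[of y j] X_mono[of "k + i" "k + j"] i(1) by auto
    qed simp
    then show ?thesis
      unfolding F_def i_def by simp
  qed
  have "uc_on (X n) (\<U> n) F" for n
  proof -
    have "uc_on (X (k + n)) (\<U> (k + n)) F"
      using f[of n] F[of _ n] unfolding P_def uc_on_def by simp
    then show ?thesis
      by (rule uc_on_restrict[rotated]) simp
  qed
  then have "openin (uniform_direct_limit X \<U>) {y \<in> Y. F y < 1/2}"
    by (rule openin_limit_sublevel)
  moreover have "x \<in> {y \<in> Y. F y < 1/2}"
    using F[of x 0] xk f[of 0] unfolding P_def by auto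
  moreover have "{y \<in> Y. F y < 1/2} \<subseteq> (\<Union>n\<in>{k..}. Q n)"
  proof
    fix y assume y: "y \<in> {y \<in> Y. F y < 1/2}"
    then obtain n where "y \<in> X n"
      by blast
    then have yn: "y \<in> X (k + n)"
      using X_mono[of n "k + n"] by auto
    then have "f n y < t n"
      using F[OF yn] y t(3)[of n] by auto
    then have "y \<in> Q (k + n)"
      using f[of n] yn unfolding P_def by blast
    then show "y \<in> (\<Union>n\<in>{k..}. Q n)"
      by auto
  qed
  ultimately show thesis
    by (rule that)
qed

end

section \<open>The box topology\<close>

lemma openin_box_topology_Pi:
  "(\<And>n. openin (C n) (G n)) \<Longrightarrow> openin (box_topology C) (Pi UNIV G)"
  unfolding box_topology_def by (rule topology_generated_by_Basis) blast

text \<open>Boxes are closed under finite intersections, so the generating family is already a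
  base.\<close>

lemma openin_box_topology_nbhd:
  assumes "openin (box_topology C) S" "s \<in> S"
  shows "\<exists>G. (\<forall>n. openin (C n) (G n)) \<and> s \<in> Pi UNIV G \<and> Pi UNIV G \<subseteq> S"
proof -
  have "generate_topology_on {Pi UNIV G |G. \<forall>n. openin (C n) (G n)} S"
    using assms(1) unfolding box_topology_def by (simp add: openin_topology_generated_by_iff)
  then show ?thesis
    using assms(2)
  proof (induction arbitrary: s)
    case (Int a b)
    then obtain G H where "\<forall>n. openin (C n) (G n)" "s \<in> Pi UNIV G" "Pi UNIV G \<subseteq> a"
      "\<forall>n. openin (C n) (H n)" "s \<in> Pi UNIV H" "Pi UNIV H \<subseteq> b"
      by (meson IntD1 IntD2)
    then have "(\<forall>n. openin (C n) (G n \<inter> H n)) \<and> s \<in> Pi UNIV (\<lambda>n. G n \<inter> H n) \<and>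
        Pi UNIV (\<lambda>n. G n \<inter> H n) \<subseteq> a \<inter> b"
      by (auto simp: Pi_iff)
    then show ?case
      by (intro exI[of _ "\<lambda>n. G n \<inter> H n"])
  next
    case (UN K)
    then obtain k where "k \<in> K" "s \<in> k"
      by blast
    then show ?case
      using UN.IH[of k s] by blast
  qed auto
qed

lemma topspace_small_box_product:
  "topspace (small_box_product C c) = {s. (\<forall>n. s n \<in> topspace (C n)) \<and> (\<exists>m. \<forall>n\<ge>m. s n = c n)}"
  unfolding small_box_product_def by (auto simp: topspace_box_topology)

lemma topspace_finite_box_product:
  "topspace (finite_box_product C c m) = {s. (\<forall>n. s n \<in> topspace (C n)) \<and> (\<forall>n\<ge>m. s n = c n)}"
  unfolding finite_box_product_def by (auto simp: topspace_small_box_product)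

lemma openin_small_box_product_Pi:
  assumes "\<And>n. openin (C n) (G n)"
  shows "openin (small_box_product C c) {s \<in> topspace (small_box_product C c). \<forall>n. s n \<in> G n}"
proof -
  have "{s \<in> topspace (small_box_product C c). \<forall>n. s n \<in> G n} =
      Pi UNIV G \<inter> {s. \<exists>m. \<forall>n\<ge>m. s n = c n}"
    using openin_subset[OF assms] unfolding topspace_small_box_product by (fastforce simp: Pi_iff)
  then show ?thesis
    using openin_box_topology_Pi[of C G, OF assms]
    unfolding small_box_product_def openin_subtopology by blast
qed

lemma openin_finite_box_product_Pi:
  assumes "\<And>n. openin (C n) (G n)"
  shows "openin (finite_box_product C c m) {s \<in> topspace (finite_box_product C c m). \<forall>n. s n \<in> G n}"
proof -
  have "{s \<in> topspace (finite_box_product C c m). \<forall>n. s n \<in> G n} =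
      {s \<in> topspace (small_box_product C c). \<forall>n. s n \<in> G n} \<inter> {s. \<forall>i\<ge>m. s i = c i}"
    unfolding topspace_small_box_product topspace_finite_box_product by blast
  then show ?thesis
    using openin_small_box_product_Pi[of C G c, OF assms]
    unfolding finite_box_product_def openin_subtopology by blast
qed

lemma openin_prod_small_box_product_nbhd:
  assumes "openin (prod_topology S (small_box_product C c)) K" "p \<in> K"
  obtains P G where "openin S P" "fst p \<in> P" "\<forall>n. openin (C n) (G n)" "\<forall>n. snd p n \<in> G n"
    "\<forall>q. fst q \<in> P \<and> (\<forall>n. snd q n \<in> G n) \<and> (\<exists>m. \<forall>n\<ge>m. snd q n = c n) \<longrightarrow> q \<in> K"
proof -
  have "\<exists>P R. openin S P \<and> openin (small_box_product C c) R \<and> fst p \<in> P \<and> snd p \<in> R \<and> P \<times> R \<subseteq> K"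
    using assms unfolding openin_prod_topology_alt by (metis prod.collapse)
  then obtain P R where PR: "openin S P" "openin (small_box_product C c) R"
    "fst p \<in> P" "snd p \<in> R" "P \<times> R \<subseteq> K"
    by blast
  then obtain R' where R': "openin (box_topology C) R'" "R = R' \<inter> {s. \<exists>m. \<forall>n\<ge>m. s n = c n}"
    unfolding small_box_product_def openin_subtopology by blast
  then obtain G where G: "\<forall>n. openin (C n) (G n)" "snd p \<in> Pi UNIV G" "Pi UNIV G \<subseteq> R'"
    using openin_box_topology_nbhd[OF R'(1), of "snd p"] PR(4) by auto
  have "q \<in> K" if q: "fst q \<in> P" "\<forall>n. snd q n \<in> G n" "\<exists>m. \<forall>n\<ge>m. snd q n = c n" for q
  proof -
    have "snd q \<in> Pi UNIV G"
      using q(2) by (simp add: Pi_iff)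
    then have "snd q \<in> R"
      using q(3) G(3) R'(2) by blast
    then show ?thesis
      using PR(5) q(1) by (metis SigmaI prod.collapse subsetD)
  qed
  then have "\<forall>q. fst q \<in> P \<and> (\<forall>n. snd q n \<in> G n) \<and> (\<exists>m. \<forall>n\<ge>m. snd q n = c n) \<longrightarrow> q \<in> K"
    by blast
  moreover have "\<forall>n. snd p n \<in> G n"
    using G(2) by (simp add: Pi_iff)
  ultimately show thesis
    by (intro that[OF PR(1,3) G(1)])
qed

lemma continuous_map_small_box_product_component:
  assumes "\<And>n. c n \<in> topspace (C n)"
  shows "continuous_map (small_box_product C c) (C i) (\<lambda>s. s i)"
  unfolding continuous_map_def
proof (intro conjI allI impI)
  show "(\<lambda>s. s i) \<in> topspace (small_box_product C c) \<rightarrow> topspace (C i)"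
    unfolding topspace_small_box_product by auto
  fix U assume U: "openin (C i) U"
  have "openin (C n) (if n = i then U else topspace (C n))" for n
    using U by simp
  from openin_small_box_product_Pi[of C "\<lambda>n. if n = i then U else topspace (C n)" c, OF this]
  show "openin (small_box_product C c) {s \<in> topspace (small_box_product C c). s i \<in> U}"
    by (rule back_subst[of "openin (small_box_product C c)"]) (auto simp: topspace_small_box_product)
qed

definition trunc :: "(nat \<Rightarrow> 'c) \<Rightarrow> nat \<Rightarrow> (nat \<Rightarrow> 'c) \<Rightarrow> nat \<Rightarrow> 'c" where
  "trunc c m s = (\<lambda>i. if i < m then s i else c i)"

lemma trunc_cong: "(\<And>i. i < m \<Longrightarrow> s i = s' i) \<Longrightarrow> trunc c m s = trunc c m s'"
  unfolding trunc_def by auto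

lemma trunc_id: "(\<And>i. m \<le> i \<Longrightarrow> s i = c i) \<Longrightarrow> trunc c m s = s"
  unfolding trunc_def by auto

text \<open>The preimage of a box is again a box, with whole spaces as factors from \<open>m\<close>
  on, or it is empty when some base point \<open>c i\<close> with \<open>i \<ge> m\<close> misses
  its factor.\<close>

lemma continuous_map_trunc:
  assumes "\<And>n. c n \<in> topspace (C n)"
  shows "continuous_map (small_box_product C c) (finite_box_product C c m) (trunc c m)"
proof -
  let ?S = "topspace (small_box_product C c)"
  have "openin (small_box_product C c) (trunc c m -` U \<inter> ?S)"
    if U: "U \<in> {Pi UNIV G |G. \<forall>n. openin (C n) (G n)}" for U
  proof -
    obtain G where G: "U = Pi UNIV G" "\<And>n. openin (C n) (G n)"
      using U by blast
    show ?thesis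
    proof (cases "\<forall>i\<ge>m. c i \<in> G i")
      case True
      have "openin (C n) (if n < m then G n else topspace (C n))" for n
        using G(2) by simp
      from openin_small_box_product_Pi[of C "\<lambda>n. if n < m then G n else topspace (C n)" c, OF this]
      show ?thesis
      proof (rule back_subst[of "openin (small_box_product C c)"])
        have "s n \<in> (if n < m then G n else topspace (C n)) \<longleftrightarrow> trunc c m s n \<in> G n" if "s \<in> ?S" for s n
          using True that unfolding trunc_def topspace_small_box_product by simp
        then show "{s \<in> ?S. \<forall>n. s n \<in> (if n < m then G n else topspace (C n))} = trunc c m -` U \<inter> ?S"
          unfolding G(1) Pi_iff by blast
      qed
    next
      case False
      then have "trunc c m -` U = {}"
        unfolding G(1) trunc_def by (auto simp: Pi_iff) (metis not_le)
      then show ?thesis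
        by simp
    qed
  qed
  moreover have "trunc c m ` ?S \<subseteq> \<Union>{Pi UNIV G |G. \<forall>n. openin (C n) (G n)}"
    using assms topspace_box_topology[of C]
    unfolding box_topology_def topology_generated_by_topspace topspace_small_box_product trunc_def by auto
  ultimately have "continuous_map (small_box_product C c) (box_topology C) (trunc c m)"
    unfolding box_topology_def by (intro continuous_on_generated_topo) auto
  then show ?thesis
    unfolding finite_box_product_def small_box_product_def[of C c] subtopology_subtopology
    by (rule continuous_map_into_subtopology) (auto simp: trunc_def intro!: exI[of _ m])
qed

section \<open>The homeomorphism onto an open subset of the limit\<close>

text \<open>One setting for both cases. In case (i) \<open>m = 0\<close>, all chart domains are
  whole spaces and \<open>\<theta>\<close> is the first projection. In case (ii) \<open>m\<close> is
  a stage containing a given point and \<open>\<theta>\<close> comes from the local homeomorphism at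
  that stage.\<close>

locale chart_tower = tower X \<U> for X :: "nat \<Rightarrow> 'a set" and \<U> :: "nat \<Rightarrow> 'a rel set" +
  fixes C :: "nat \<Rightarrow> 'c topology" and c :: "nat \<Rightarrow> 'c" and m :: nat
    and V :: "nat \<Rightarrow> 'c set" and N :: "nat \<Rightarrow> 'a set" and \<gamma> :: "nat \<Rightarrow> 'a \<times> 'c \<Rightarrow> 'a"
    and W :: "('a \<times> (nat \<Rightarrow> 'c)) set" and B :: "'a set" and \<theta> :: "'a \<times> (nat \<Rightarrow> 'c) \<Rightarrow> 'a"
  assumes pointed: "c n \<in> topspace (C n)"
    and chart: "m \<le> n \<Longrightarrow>
      complement_chart (X (Suc n)) (\<U> (Suc n)) (X n) (C n) (c n) (V n) (N n) (\<gamma> n)"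
    and W: "openin (prod_topology (uniform_topology (X 0) (\<U> 0)) (finite_box_product C c m)) W"
    and B: "openin (uniform_topology (X m) (\<U> m)) B"
    and \<theta>: "homeomorphic_map
      (subtopology (prod_topology (uniform_topology (X 0) (\<U> 0)) (finite_box_product C c m)) W)
      (subtopology (uniform_topology (X m) (\<U> m)) B) \<theta>"
begin

abbreviation "S \<equiv> prod_topology (T 0) (small_box_product C c)"

text \<open>The domain of the limit map: \<open>W\<close> restricts the point of \<open>X 0\<close>
  and the coordinates below \<open>m\<close>, while \<open>V n\<close> makes the \<open>n\<close>-th
  chart applicable.\<close>

definition K :: "('a \<times> (nat \<Rightarrow> 'c)) set" where
  "K = {p \<in> topspace S. (fst p, trunc c m (snd p)) \<in> W \<and> (\<forall>n\<ge>m. snd p n \<in> V n)}"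

text \<open>The construction starts at stage \<open>m\<close>. Below \<open>m\<close> the value of
  \<open>\<theta>\<close> serves as a default, so that \<open>lift m\<close> is
  \<open>\<theta>\<close> of the truncated point and the chart \<open>\<gamma> m\<close> is the
  first to be applied.\<close>

primrec lift :: "nat \<Rightarrow> 'a \<times> (nat \<Rightarrow> 'c) \<Rightarrow> 'a" where
  "lift 0 p = \<theta> (fst p, trunc c m (snd p))"
| "lift (Suc n) p = (if n < m then lift n p else \<gamma> n (lift n p, snd p n))"

definition supported :: "nat \<Rightarrow> 'a \<times> (nat \<Rightarrow> 'c) \<Rightarrow> bool" where
  "supported n p \<longleftrightarrow> m \<le> n \<and> (\<forall>i\<ge>n. snd p i = c i)"

text \<open>Since \<open>\<gamma> n (a, c n) = a\<close>, the sequence \<open>lift n p\<close> is constant from the first \<open>n\<close> with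
  \<open>supported n p\<close> on.\<close>

definition limit_map :: "'a \<times> (nat \<Rightarrow> 'c) \<Rightarrow> 'a" where
  "limit_map p = lift (LEAST n. supported n p) p"

section \<open>Charts as open embeddings, and the domain \<open>K\<close>\<close>

lemma homeo_\<gamma>:
  assumes "m \<le> n"
  shows "homeomorphic_map (prod_topology (T n) (subtopology (C n) (V n))) (subtopology (T (Suc n)) (N n)) (\<gamma> n)"
  using chart[OF assms] stage_subtopology[of n "Suc n"] unfolding complement_chart_def by simp

lemma chart_sets:
  assumes "m \<le> n"
  shows "openin (C n) (V n)" "c n \<in> V n" "openin (T (Suc n)) (N n)" "V n \<subseteq> topspace (C n)"
    "N n \<subseteq> X (Suc n)"
proof -
  show *: "openin (C n) (V n)" "c n \<in> V n" "openin (T (Suc n)) (N n)"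
    using chart[OF assms] unfolding complement_chart_def by auto
  show "V n \<subseteq> topspace (C n)" "N n \<subseteq> X (Suc n)"
    using openin_subset[OF *(1)] openin_subset[OF *(3)] topspace_stage by auto
qed

lemma \<gamma>_continuous:
  "m \<le> n \<Longrightarrow> continuous_map (prod_topology (T n) (subtopology (C n) (V n))) (T (Suc n)) (\<gamma> n)"
  using homeomorphic_imp_continuous_map[OF homeo_\<gamma>] continuous_map_in_subtopology by blast

lemma \<gamma>_dom: "m \<le> n \<Longrightarrow> topspace (prod_topology (T n) (subtopology (C n) (V n))) = X n \<times> V n"
  using chart_sets(4)[of n] by (simp add: topspace_stage inf.absorb2)

lemma \<gamma>_image:
  assumes "m \<le> n"
  shows "\<gamma> n ` (X n \<times> V n) = N n"
  using homeomorphic_imp_surjective_map[OF homeo_\<gamma>[OF assms]] chart_sets(5)[OF assms]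
  unfolding \<gamma>_dom[OF assms] by (simp add: topspace_stage inf.absorb2)

lemma \<gamma>_inj: "m \<le> n \<Longrightarrow> inj_on (\<gamma> n) (X n \<times> V n)"
  using homeomorphic_imp_injective_map[OF homeo_\<gamma>] \<gamma>_dom by metis

lemma \<gamma>_open:
  assumes n: "m \<le> n" and P: "openin (T n) P" and G: "openin (C n) G"
  shows "openin (T (Suc n)) (\<gamma> n ` (P \<times> (G \<inter> V n)))"
proof -
  have "openin (subtopology (C n) (V n)) (G \<inter> V n)"
    using G by (auto simp: openin_subtopology)
  then have "openin (prod_topology (T n) (subtopology (C n) (V n))) (P \<times> (G \<inter> V n))"
    using P by (simp add: openin_prod_Times_iff)
  then have "openin (subtopology (T (Suc n)) (N n)) (\<gamma> n ` (P \<times> (G \<inter> V n)))"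
    using homeomorphic_imp_open_map[OF homeo_\<gamma>[OF n]] unfolding open_map_def by blast
  then show ?thesis
    using openin_trans_full chart_sets(3)[OF n] by blast
qed

lemma \<gamma>_base: "m \<le> n \<Longrightarrow> a \<in> X n \<Longrightarrow> \<gamma> n (a, c n) = a"
  by (rule complement_chart_base_point[OF hausdorff chart])

lemma W_subset: "q \<in> W \<Longrightarrow> fst q \<in> X 0 \<and> snd q \<in> topspace (finite_box_product C c m)"
  using openin_subset[OF W] topspace_stage by auto

lemma K_iff: "p \<in> K \<longleftrightarrow> fst p \<in> X 0 \<and> snd p \<in> topspace (small_box_product C c) \<and>
    (fst p, trunc c m (snd p)) \<in> W \<and> (\<forall>n\<ge>m. snd p n \<in> V n)"
  unfolding K_def by (cases p) (simp add: topspace_stage)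

lemma W_in_K:
  assumes "q \<in> W"
  shows "q \<in> K" "trunc c m (snd q) = snd q" "supported m q"
proof -
  have q: "fst q \<in> X 0" "\<forall>n. snd q n \<in> topspace (C n)" "\<forall>n\<ge>m. snd q n = c n"
    using W_subset[OF assms] by (auto simp: topspace_finite_box_product)
  then show tr: "trunc c m (snd q) = snd q"
    by (intro trunc_id) simp
  show "supported m q"
    using q(3) unfolding supported_def by simp
  show "q \<in> K"
    unfolding K_iff tr topspace_small_box_product using q assms chart_sets(2) by auto
qed

lemma continuous_map_truncate: "continuous_map S (prod_topology (T 0) (finite_box_product C c m))
    (\<lambda>p. (fst p, trunc c m (snd p)))"
  by (intro continuous_map_pairedI continuous_map_fst
      continuous_map_compose[OF continuous_map_snd continuous_map_trunc, unfolded o_def] pointed)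

lemma openin_K: "openin S K"
proof -
  let ?G = "\<lambda>n. if m \<le> n then V n else topspace (C n)"
  have "openin S {p \<in> topspace S. (fst p, trunc c m (snd p)) \<in> W}"
    by (rule openin_continuous_map_preimage[OF continuous_map_truncate W])
  moreover have "openin (C n) (?G n)" for n
    using chart_sets(1) by simp
  from openin_small_box_product_Pi[of C ?G c, OF this]
  have "openin S (X 0 \<times> {s \<in> topspace (small_box_product C c). \<forall>n. s n \<in> ?G n})"
    using openin_topspace[of "T 0"] topspace_stage by (simp add: openin_prod_Times_iff)
  ultimately have "openin S ({p \<in> topspace S. (fst p, trunc c m (snd p)) \<in> W} \<inter>
      X 0 \<times> {s \<in> topspace (small_box_product C c). \<forall>n. s n \<in> ?G n})"
    by (rule openin_Int)
  then show ?thesis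
    by (rule back_subst[of "openin S"])
      (auto simp: K_def topspace_stage topspace_small_box_product)
qed

lemma topspace_subtopology_K: "topspace (subtopology S K) = K"
  using openin_subset[OF openin_K] by (simp add: inf.absorb2)

section \<open>Continuity and stabilization of the lifts\<close>

lemma lift_start: "n \<le> m \<Longrightarrow> lift n p = \<theta> (fst p, trunc c m (snd p))"
  by (induction n) auto

lemma lift_cong:
  assumes "fst p = fst q" "\<And>i. i < n \<Longrightarrow> snd p i = snd q i" "m \<le> n"
  shows "lift n p = lift n q"
  using assms(3,2)
proof (induction rule: dec_induct)
  case base
  then show ?case
    using assms(1) trunc_cong[of m "snd p" "snd q" c] by (simp add: lift_start)
qed simp

lemma lift_continuous:
  assumes "m \<le> n"
  shows "continuous_map (subtopology S K) (T n) (lift n)"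
  using assms
proof (induction rule: dec_induct)
  case base
  have "continuous_map (subtopology S K)
      (subtopology (prod_topology (T 0) (finite_box_product C c m)) W) (\<lambda>p. (fst p, trunc c m (snd p)))"
    using continuous_map_from_subtopology[OF continuous_map_truncate]
    by (rule continuous_map_into_subtopology) (auto simp: K_def)
  moreover have "continuous_map (subtopology (prod_topology (T 0) (finite_box_product C c m)) W) (T m) \<theta>"
    using homeomorphic_imp_continuous_map[OF \<theta>] continuous_map_in_subtopology by blast
  ultimately have "continuous_map (subtopology S K) (T m) (\<lambda>p. \<theta> (fst p, trunc c m (snd p)))"
    using continuous_map_compose[unfolded o_def] by blast
  then show ?case
    by (simp add: lift_start)
next
  case (step n)
  have "continuous_map S (C n) (\<lambda>p. snd p n)"
    using continuous_map_compose[OF continuous_map_snd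
        continuous_map_small_box_product_component[of c C n, OF pointed]] by (simp add: o_def)
  then have "continuous_map (subtopology S K) (subtopology (C n) (V n)) (\<lambda>p. snd p n)"
    using step.hyps(1)
    by (intro continuous_map_into_subtopology continuous_map_from_subtopology) (auto simp: K_def)
  then have "continuous_map (subtopology S K) (prod_topology (T n) (subtopology (C n) (V n)))
      (\<lambda>p. (lift n p, snd p n))"
    by (rule continuous_map_pairedI[OF step.IH])
  from continuous_map_compose[OF this \<gamma>_continuous[OF step.hyps(1)]]
  show ?case
    using step.hyps(1) by (simp add: o_def)
qed

lemma lift_in: "m \<le> n \<Longrightarrow> p \<in> K \<Longrightarrow> lift n p \<in> X n"
  using continuous_map_image_subset_topspace[OF lift_continuous, of n]
  unfolding topspace_subtopology_K topspace_stage by blast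

lemma supported_mono: "supported k p \<Longrightarrow> k \<le> n \<Longrightarrow> supported n p"
  unfolding supported_def by auto

lemma lift_stable:
  assumes p: "p \<in> K" "supported k p" and "k \<le> n"
  shows "lift n p = lift k p"
  using assms(3)
proof (induction rule: dec_induct)
  case (step n)
  have "m \<le> n" "snd p n = c n"
    using p(2) step.hyps(1) unfolding supported_def by auto
  then show ?case
    using step.IH \<gamma>_base[of n "lift n p"] lift_in[OF _ p(1), of n] by simp
qed simp

lemma limit_map_eq: "p \<in> K \<Longrightarrow> supported n p \<Longrightarrow> limit_map p = lift n p"
  unfolding limit_map_def using lift_stable[of p "LEAST n. supported n p" n]
  by (metis LeastI Least_le)

lemma K_supported:
  assumes "p \<in> K"
  obtains n where "supported n p"
proof -
  obtain k where "\<forall>i\<ge>k. snd p i = c i"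
    using assms unfolding K_iff topspace_small_box_product by blast
  then have "supported (max k m) p"
    unfolding supported_def by simp
  then show thesis
    by (rule that)
qed

section \<open>Images of boxes and openness of the limit map\<close>

definition support_box :: "'a set \<Rightarrow> (nat \<Rightarrow> 'c set) \<Rightarrow> nat \<Rightarrow> ('a \<times> (nat \<Rightarrow> 'c)) set" where
  "support_box P G n = {p \<in> K. supported n p \<and> fst p \<in> P \<and> (\<forall>i<n. snd p i \<in> G i)}"

lemma lift_box_start:
  "lift m ` support_box P G m = \<theta> ` (W \<inter> {q. fst q \<in> P \<and> (\<forall>i<m. snd q i \<in> G i)})"
proof -
  have 1: "support_box P G m = W \<inter> {q. fst q \<in> P \<and> (\<forall>i<m. snd q i \<in> G i)}"
  proof -
    have "p \<in> W" if "p \<in> K" "supported m p" for p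
    proof -
      have "trunc c m (snd p) = snd p"
        using that(2) unfolding supported_def by (intro trunc_id) simp
      then show ?thesis
        using that(1) unfolding K_iff by simp
    qed
    then show ?thesis
      unfolding support_box_def using W_in_K by blast
  qed
  have "lift m p = \<theta> p" if "p \<in> W" for p
    using W_in_K(2)[OF that] by (simp add: lift_start)
  then show ?thesis
    unfolding 1 by (intro image_cong) auto
qed

text \<open>Coordinate \<open>n\<close> can be split off: \<open>lift n\<close> sees only the
  coordinates below \<open>n\<close>, so changing coordinate \<open>n\<close> between a value in the
  chart domain and the base point leaves \<open>lift n\<close> fixed and moves the support bound
  between \<open>Suc n\<close> and \<open>n\<close>.\<close>

lemma lift_box_Suc:
  assumes n: "m \<le> n"
  shows "lift (Suc n) ` support_box P G (Suc n) = \<gamma> n ` (lift n ` support_box P G n \<times> (G n \<inter> V n))"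
proof (intro equalityI subsetI)
  fix z assume "z \<in> lift (Suc n) ` support_box P G (Suc n)"
  then obtain p where p: "p \<in> support_box P G (Suc n)" "z = lift (Suc n) p"
    by blast
  \<comment> \<open>At level \<open>n\<close> the box constrains only coordinates below
    \<open>n\<close>, so the base point may be put at coordinate \<open>n\<close> whether or not it
    lies in \<open>G n\<close>.\<close>
  define q where "q = (fst p, (snd p)(n := c n))"
  have pK: "p \<in> K" "supported (Suc n) p" "fst p \<in> P" "\<forall>i<Suc n. snd p i \<in> G i"
    using p(1) unfolding support_box_def by auto
  have tr: "trunc c m ((snd p)(n := c n)) = trunc c m (snd p)"
    using n by (intro trunc_cong) simp
  have sq: "supported n q"
    using pK(2) n unfolding supported_def q_def by (auto simp: Suc_le_eq)
  moreover have "snd q \<in> topspace (small_box_product C c)"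
    using pK(1) pointed sq unfolding K_iff topspace_small_box_product supported_def
    by (auto simp: q_def)
  ultimately have "q \<in> support_box P G n"
    using pK chart_sets(2)[OF n] unfolding support_box_def K_iff by (auto simp: q_def tr)
  moreover have "lift n q = lift n p"
    using n by (intro lift_cong) (auto simp: q_def)
  ultimately have "lift n p \<in> lift n ` support_box P G n"
    by (metis imageI)
  moreover have "snd p n \<in> G n \<inter> V n"
    using pK n unfolding K_iff by auto
  ultimately show "z \<in> \<gamma> n ` (lift n ` support_box P G n \<times> (G n \<inter> V n))"
    using p(2) n by auto
next
  fix z assume "z \<in> \<gamma> n ` (lift n ` support_box P G n \<times> (G n \<inter> V n))"
  then obtain p v where p: "p \<in> support_box P G n" "v \<in> G n" "v \<in> V n" "z = \<gamma> n (lift n p, v)"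
    by blast
  define q where "q = (fst p, (snd p)(n := v))"
  have pK: "p \<in> K" "supported n p" "fst p \<in> P" "\<forall>i<n. snd p i \<in> G i"
    using p(1) unfolding support_box_def by auto
  have tr: "trunc c m ((snd p)(n := v)) = trunc c m (snd p)"
    using n by (intro trunc_cong) simp
  have sq: "supported (Suc n) q"
    using pK(2) n unfolding supported_def q_def by auto
  moreover have "v \<in> topspace (C n)"
    using chart_sets(4)[OF n] p(3) by blast
  then have "\<forall>i. snd q i \<in> topspace (C i)"
    using pK(1) unfolding K_iff topspace_small_box_product by (simp add: q_def)
  then have "snd q \<in> topspace (small_box_product C c)"
    using sq unfolding topspace_small_box_product supported_def by blast
  ultimately have "q \<in> support_box P G (Suc n)"
    using pK p(2,3) unfolding support_box_def K_iff by (auto simp: q_def tr less_Suc_eq)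
  moreover have "lift n q = lift n p"
    using n by (intro lift_cong) (auto simp: q_def)
  then have "lift (Suc n) q = z"
    using n p(4) by (simp add: q_def)
  ultimately show "z \<in> lift (Suc n) ` support_box P G (Suc n)"
    by blast
qed

lemma openin_lift_box:
  assumes P: "openin (T 0) P" and G: "\<And>n. openin (C n) (G n)" and n: "m \<le> n"
  shows "openin (T n) (lift n ` support_box P G n)"
  using n
proof (induction rule: dec_induct)
  case base
  let ?F = "prod_topology (T 0) (finite_box_product C c m)"
  let ?G = "\<lambda>n. if n < m then G n else topspace (C n)"
  have "openin (C n) (?G n)" for n
    using G by simp
  from openin_finite_box_product_Pi[of C ?G c m, OF this]
  have "openin ?F (P \<times> {s \<in> topspace (finite_box_product C c m). \<forall>n. s n \<in> ?G n})"
    using P by (simp add: openin_prod_Times_iff)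
  then have "openin (subtopology ?F W) (W \<inter> P \<times> {s \<in> topspace (finite_box_product C c m). \<forall>n. s n \<in> ?G n})"
    by (rule openin_subtopology_Int2)
  moreover have "(\<forall>n. s n \<in> ?G n) \<longleftrightarrow> (\<forall>i<m. s i \<in> G i)"
    if "s \<in> topspace (finite_box_product C c m)" for s
    using that unfolding topspace_finite_box_product by (smt (verit) mem_Collect_eq)
  then have "q \<in> P \<times> {s \<in> topspace (finite_box_product C c m). \<forall>n. s n \<in> ?G n} \<longleftrightarrow>
      fst q \<in> P \<and> (\<forall>i<m. snd q i \<in> G i)" if "q \<in> W" for q
    using W_subset[OF that] by (cases q) auto
  then have "W \<inter> P \<times> {s \<in> topspace (finite_box_product C c m). \<forall>n. s n \<in> ?G n} =
      W \<inter> {q. fst q \<in> P \<and> (\<forall>i<m. snd q i \<in> G i)}"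
    by blast
  ultimately have "openin (subtopology (T m) B) (\<theta> ` (W \<inter> {q. fst q \<in> P \<and> (\<forall>i<m. snd q i \<in> G i)}))"
    using homeomorphic_imp_open_map[OF \<theta>] unfolding open_map_def by simp
  then show ?case
    unfolding lift_box_start using openin_trans_full B by blast
next
  case (step n)
  then show ?case
    using \<gamma>_open[OF step.hyps(1) step.IH G] lift_box_Suc[OF step.hyps(1), of P G] by simp
qed

text \<open>Around a point supported at \<open>k\<close>, the images under \<open>lift n\<close> of
  a basic box inside \<open>K'\<close> form a sequence as in \<open>limit_neighbourhood\<close>, and
  the union of these images over \<open>n \<ge> k\<close> stays in the image of
  \<open>K'\<close>.\<close>

lemma openin_limit_map_image:
  assumes K': "openin S K'" "K' \<subseteq> K"
  shows "openin (uniform_direct_limit X \<U>) (limit_map ` K')"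
proof (subst openin_subopen, intro ballI)
  fix z assume "z \<in> limit_map ` K'"
  then obtain p where p: "p \<in> K'" "z = limit_map p"
    by blast
  then have pK: "p \<in> K"
    using K'(2) by blast
  then obtain k where k: "supported k p"
    by (rule K_supported)
  then have mk: "m \<le> k"
    unfolding supported_def by simp
  obtain P G where PG: "openin (T 0) P" "fst p \<in> P" "\<forall>n. openin (C n) (G n)" "\<forall>n. snd p n \<in> G n"
    "\<forall>q. fst q \<in> P \<and> (\<forall>n. snd q n \<in> G n) \<and> (\<exists>m. \<forall>n\<ge>m. snd q n = c n) \<longrightarrow> q \<in> K'"
    by (rule openin_prod_small_box_product_nbhd[OF K'(1) p(1)])
  \<comment> \<open>From \<open>k\<close> on the coordinates of \<open>p\<close> are base points, so
    the factors of any box around \<open>p\<close> contain them.\<close>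
  have cG: "c n \<in> G n" if "k \<le> n" for n
    using PG(4) k that unfolding supported_def by metis
  have chart': "complement_chart (X (Suc n)) (\<U> (Suc n)) (X n) (C n) (c n) (V n) (N n) (\<gamma> n)"
    if "k \<le> n" for n
    using chart mk that by simp
  have Qk: "openin (T k) (lift k ` support_box P G k)"
    using openin_lift_box PG(1,3) mk by blast
  have "p \<in> support_box P G k"
    unfolding support_box_def using pK k PG(2,4) by blast
  then have z: "z \<in> lift k ` support_box P G k"
    unfolding p(2) limit_map_eq[OF pK k] by (rule imageI)
  have step: "\<gamma> n ` (lift n ` support_box P G n \<times> (G n \<inter> V n)) \<subseteq> lift (Suc n) ` support_box P G (Suc n)" if "k \<le> n" for n
    using lift_box_Suc[of n P G] mk that by simp
  have Gopen: "openin (C n) (G n)" for n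
    using PG(3) by simp
  obtain \<Omega> where \<Omega>: "openin (uniform_direct_limit X \<U>) \<Omega>" "z \<in> \<Omega>" "\<Omega> \<subseteq> (\<Union>n\<in>{k..}. lift n ` support_box P G n)"
    by (rule limit_neighbourhood[where Q = "\<lambda>n. lift n ` support_box P G n", OF chart' Gopen cG Qk z step])
  have "lift n ` support_box P G n \<subseteq> limit_map ` K'" if n: "k \<le> n" for n
  proof
    fix y assume "y \<in> lift n ` support_box P G n"
    then obtain q where q: "q \<in> K" "supported n q" "fst q \<in> P" "\<forall>i<n. snd q i \<in> G i" "y = lift n q"
      unfolding support_box_def by blast
    have "snd q i \<in> G i" for i
    proof (cases "i < n")
      case False
      then show ?thesis
        using q(2) cG[of i] n unfolding supported_def by simp
    qed (use q(4) in blast)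
    moreover have "\<exists>m. \<forall>n\<ge>m. snd q n = c n"
      using q(2) unfolding supported_def by blast
    ultimately have "q \<in> K'"
      using PG(5) q(3) by blast
    then show "y \<in> limit_map ` K'"
      using q(5) limit_map_eq[OF q(1,2)] by (metis imageI)
  qed
  then have "(\<Union>n\<in>{k..}. lift n ` support_box P G n) \<subseteq> limit_map ` K'"
    by (intro UN_least) simp
  with \<Omega>(3) have "\<Omega> \<subseteq> limit_map ` K'"
    by (rule order_trans)
  with \<Omega>(1,2) show "\<exists>\<Omega>. openin (uniform_direct_limit X \<U>) \<Omega> \<and> z \<in> \<Omega> \<and> \<Omega> \<subseteq> limit_map ` K'"
    by (intro exI conjI)
qed

section \<open>Injectivity, continuity and image of the limit map\<close>

lemma inj_on_limit_map: "inj_on limit_map K"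
proof (rule inj_onI)
  fix p q assume p: "p \<in> K" and q: "q \<in> K" and eq: "limit_map p = limit_map q"
  obtain i j where ij: "supported i p" "supported j q"
    using K_supported[OF p] K_supported[OF q] by metis
  define n where "n = max i j"
  have n: "supported n p" "supported n q"
    using ij supported_mono unfolding n_def by auto
  then have mn: "m \<le> n"
    unfolding supported_def by simp
  have "lift n p = lift n q"
    using eq limit_map_eq n p q by metis
  \<comment> \<open>At a common stage of support the charts are peeled off one at a time by
    injectivity, down to \<open>\<theta>\<close>, which determines the remaining
    coordinates.\<close>
  with mn have "fst p = fst q \<and> (\<forall>i<n. snd p i = snd q i)"
  proof (induction rule: dec_induct)
    case base
    have WW: "(fst p, trunc c m (snd p)) \<in> W" "(fst q, trunc c m (snd q)) \<in> W"
      using p q unfolding K_iff by simp_all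
    have "inj_on \<theta> W"
      using homeomorphic_imp_injective_map[OF \<theta>] openin_subset[OF W] by (simp add: inf.absorb2)
    then have "(fst p, trunc c m (snd p)) = (fst q, trunc c m (snd q))"
      using WW base by (simp add: inj_on_eq_iff lift_start)
    then have "fst p = fst q" "trunc c m (snd p) = trunc c m (snd q)"
      by simp_all
    moreover have "snd p i = snd q i" if "i < m" for i
      using fun_cong[OF calculation(2), of i] that by (simp add: trunc_def)
    ultimately show ?case
      by simp
  next
    case (step n)
    have "(lift n p, snd p n) \<in> X n \<times> V n" "(lift n q, snd q n) \<in> X n \<times> V n"
      using lift_in[OF step.hyps(1)] p q step.hyps(1) unfolding K_iff by auto
    moreover have "\<gamma> n (lift n p, snd p n) = \<gamma> n (lift n q, snd q n)"
      using step.prems step.hyps(1) by simp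
    ultimately have "lift n p = lift n q" "snd p n = snd q n"
      using \<gamma>_inj[OF step.hyps(1)] by (auto dest: inj_onD)
    then show ?case
      using step.IH by (auto simp: less_Suc_eq)
  qed
  moreover have "snd p i = snd q i" if "n \<le> i" for i
    using n that unfolding supported_def by simp
  ultimately show "p = q"
    by (intro prod_eqI ext) (metis not_le)+
qed

text \<open>Near \<open>p\<close> the point \<open>lift k q\<close> is controlled by continuity of a
  single lift. The later charts are controlled by condition (2): their displacements are confined to
  successive square roots of an entourage, so that any finite number of them composes to a bounded
  total.\<close>

lemma continuous_limit_map: "continuous_map (subtopology S K) (uniform_direct_limit X \<U>) limit_map"
  unfolding continuous_map_def
proof (intro conjI allI impI)
  show "limit_map \<in> topspace (subtopology S K) \<rightarrow> topspace (uniform_direct_limit X \<U>)"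
  proof
    fix p assume "p \<in> topspace (subtopology S K)"
    then have p: "p \<in> K"
      unfolding topspace_subtopology_K .
    obtain n where n: "supported n p"
      using p by (rule K_supported)
    then have "limit_map p \<in> X n"
      using limit_map_eq[OF p n] lift_in[of n p] p unfolding supported_def by simp
    then show "limit_map p \<in> topspace (uniform_direct_limit X \<U>)"
      unfolding topspace_limit by blast
  qed
  fix O' assume O': "openin (uniform_direct_limit X \<U>) O'"
  show "openin (subtopology S K) {p \<in> topspace (subtopology S K). limit_map p \<in> O'}"
    unfolding topspace_subtopology_K
  proof (subst openin_subopen, intro ballI)
    fix p assume "p \<in> {p \<in> K. limit_map p \<in> O'}"
    then have p: "p \<in> K" "limit_map p \<in> O'"
      by auto
    obtain k where k: "supported k p"
      using p(1) by (rule K_supported)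
    then have mk: "m \<le> k"
      unfolding supported_def by simp
    have Hp: "limit_map p = lift k p"
      by (rule limit_map_eq[OF p(1) k])
    obtain E0 where E0: "E0 \<in> \<W>" "ent_ball Y (limit_map p) E0 \<subseteq> O'"
      using O' p(2) unfolding openin_limit by blast
    have "\<exists>E. \<forall>j. (E j \<in> \<W> \<and> E j \<subseteq> E0) \<and> E (Suc j) O E (Suc j) \<subseteq> E j"
    proof (rule dependent_nat_choice)
      show "\<exists>E. E \<in> \<W> \<and> E \<subseteq> E0"
        using E0(1) by blast
      show "\<exists>F. (F \<in> \<W> \<and> F \<subseteq> E0) \<and> F O F \<subseteq> E" if "E \<in> \<W> \<and> E \<subseteq> E0" for E :: "'a rel" and j :: nat
        using uniform_structure_cube_root[OF limit_unif, of E] that by (metis order_trans)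
    qed
    then obtain E where E: "\<And>j. E j \<in> \<W>" "\<And>j. E (Suc j) O E (Suc j) \<subseteq> E j" "\<And>j. E j \<subseteq> E0"
      by blast
    have E_refl: "(y, y) \<in> E j" if "y \<in> Y" for y j
      using uniform_structureD(3)[OF limit_unif E(1)] that by blast
    \<comment> \<open>The index leaves room for two factors: the displacement at stage
      \<open>n\<close> and the whole tail after it are both in \<open>E (Suc (Suc (n - k)))\<close>,
      so the tail from \<open>n\<close> on is in \<open>E (Suc (n - k))\<close>, which is
      \<open>E 1\<close> at \<open>n = k\<close>.\<close>
    have "\<exists>G. openin (C n) G \<and> c n \<in> G \<and> (\<forall>a\<in>X n. \<forall>w\<in>G. (\<gamma> n (a, w), a) \<in> E (Suc (Suc (n - k))))"
      if n: "k \<le> n" for n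
    proof -
      have "E (Suc (Suc (n - k))) \<inter> X (Suc n) \<times> X (Suc n) \<in> \<U> (Suc n)"
        by (rule limit_entourage[OF E(1)])
      then obtain G where "openin (C n) G" "c n \<in> G"
        "\<forall>a\<in>X n. \<forall>w\<in>G. (\<gamma> n (a, w), a) \<in> E (Suc (Suc (n - k))) \<inter> X (Suc n) \<times> X (Suc n)"
        using chart[of n] mk n unfolding complement_chart_def by (meson order_trans)
      then show ?thesis
        by blast
    qed
    then obtain G0 where G0: "\<And>n. k \<le> n \<Longrightarrow> openin (C n) (G0 n)" "\<And>n. k \<le> n \<Longrightarrow> c n \<in> G0 n"
      "\<And>n a w. k \<le> n \<Longrightarrow> a \<in> X n \<Longrightarrow> w \<in> G0 n \<Longrightarrow> (\<gamma> n (a, w), a) \<in> E (Suc (Suc (n - k)))"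
      by metis
    \<comment> \<open>Below \<open>k\<close> no box condition is imposed; those coordinates are
      controlled through \<open>lift k q \<in> M\<close>.\<close>
    define G where "G n = (if k \<le> n then G0 n else topspace (C n))" for n
    have "E 1 \<inter> X k \<times> X k \<in> \<U> k"
      by (rule limit_entourage[OF E(1)])
    then obtain M where M: "openin (T k) M" "lift k p \<in> M" "M \<subseteq> ent_ball (X k) (lift k p) (E 1 \<inter> X k \<times> X k)"
      using uniform_ball_nbhd[OF unif lift_in[OF mk p(1)]] by metis
    define D where "D = {q \<in> K. lift k q \<in> M} \<inter> {q \<in> K. \<forall>n. snd q n \<in> G n}"
    have "openin (subtopology S K) {q \<in> K. lift k q \<in> M}"
      using openin_continuous_map_preimage[OF lift_continuous[OF mk] M(1)]
      unfolding topspace_subtopology_K .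
    moreover have "openin (C n) (G n)" for n
      using G0(1) unfolding G_def by simp
    from openin_small_box_product_Pi[of C G c, OF this]
    have "openin S (X 0 \<times> {s \<in> topspace (small_box_product C c). \<forall>n. s n \<in> G n})"
      using openin_topspace[of "T 0"] topspace_stage by (simp add: openin_prod_Times_iff)
    then have "openin (subtopology S K) (K \<inter> X 0 \<times> {s \<in> topspace (small_box_product C c). \<forall>n. s n \<in> G n})"
      by (rule openin_subtopology_Int2)
    then have "openin (subtopology S K) {q \<in> K. \<forall>n. snd q n \<in> G n}"
      by (rule back_subst[of "openin (subtopology S K)"]) (auto simp: K_iff)
    ultimately have "openin (subtopology S K) D"
      unfolding D_def by (rule openin_Int)
    moreover have "snd p n \<in> G n" for n
    proof (cases "k \<le> n")
      case True
      then show ?thesis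
        using k G0(2)[of n] unfolding supported_def G_def by simp
    next
      case False
      then show ?thesis
        using p(1) unfolding K_iff topspace_small_box_product G_def by simp
    qed
    then have "p \<in> D"
      using p(1) M(2) unfolding D_def by blast
    moreover have "D \<subseteq> {p \<in> K. limit_map p \<in> O'}"
    proof
      fix q assume "q \<in> D"
      then have q: "q \<in> K" "lift k q \<in> M" "\<And>n. snd q n \<in> G n"
        unfolding D_def by auto
      \<comment> \<open>The induction runs on the length \<open>r\<close> with the start
        \<open>n\<close> free: the first step is bounded directly and the rest is the tail starting
        at \<open>Suc n\<close>.\<close>
      have chain: "(lift (n + r) q, lift n q) \<in> E (Suc (n - k))" if "k \<le> n" for n r
        using that
      proof (induction r arbitrary: n)
        case 0
        then have "lift n q \<in> X n"
          using lift_in[of n q] q(1) mk by simp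
        then show ?case
          using E_refl by auto
      next
        case (Suc r)
        have "(lift (Suc n + r) q, lift (Suc n) q) \<in> E (Suc (Suc n - k))"
          using Suc.IH[of "Suc n"] Suc.prems by simp
        then have "(lift (n + Suc r) q, lift (Suc n) q) \<in> E (Suc (Suc (n - k)))"
          using Suc.prems by (simp add: Suc_diff_le)
        moreover have "snd q n \<in> G0 n"
          using q(3)[of n] Suc.prems unfolding G_def by simp
        then have "(\<gamma> n (lift n q, snd q n), lift n q) \<in> E (Suc (Suc (n - k)))"
          using G0(3) lift_in[of n q] q(1) mk Suc.prems by simp
        then have "(lift (Suc n) q, lift n q) \<in> E (Suc (Suc (n - k)))"
          using mk Suc.prems by simp
        ultimately show ?case
          using E(2)[of "Suc (n - k)"] by blast
      qed
      obtain j where "supported j q"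
        using q(1) by (rule K_supported)
      then have j: "supported (k + j) q"
        by (rule supported_mono) simp
      have "(limit_map q, lift k q) \<in> E (Suc 0)"
        using chain[of k j] limit_map_eq[OF q(1) j] by simp
      moreover have "(lift k q, lift k p) \<in> E (Suc 0)"
        using q(2) M(3) unfolding ent_ball_def by auto
      ultimately have "(limit_map q, lift k p) \<in> E (Suc 0) O E (Suc 0)"
        by (rule relcompI)
      then have "(limit_map q, limit_map p) \<in> E0"
        unfolding Hp using E(2)[of 0] E(3)[of 0] by (meson subsetD)
      moreover have "limit_map q \<in> X (k + j)"
        using limit_map_eq[OF q(1) j] lift_in[of "k + j" q] q(1) mk by simp
      ultimately have "limit_map q \<in> ent_ball Y (limit_map p) E0"
        unfolding ent_ball_def by blast
      then show "q \<in> {p \<in> K. limit_map p \<in> O'}"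
        using E0(2) q(1) by blast
    qed
    ultimately show "\<exists>D. openin (subtopology S K) D \<and> p \<in> D \<and> D \<subseteq> {p \<in> K. limit_map p \<in> O'}"
      by blast
  qed
qed

lemma homeomorphic_limit_map:
  "homeomorphic_map (subtopology S K) (subtopology (uniform_direct_limit X \<U>) (limit_map ` K)) limit_map"
proof (rule bijective_open_imp_homeomorphic_map)
  have HK: "openin (uniform_direct_limit X \<U>) (limit_map ` K)"
    by (rule openin_limit_map_image[OF openin_K order_refl])
  show "continuous_map (subtopology S K) (subtopology (uniform_direct_limit X \<U>) (limit_map ` K)) limit_map"
    using continuous_limit_map by (rule continuous_map_into_subtopology) (auto simp: topspace_subtopology_K)
  show "open_map (subtopology S K) (subtopology (uniform_direct_limit X \<U>) (limit_map ` K)) limit_map"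
    unfolding open_map_def
  proof (intro allI impI)
    fix U assume "openin (subtopology S K) U"
    then have "openin S U" "U \<subseteq> K"
      using openin_trans_full[OF _ openin_K] openin_subset topspace_subtopology_K by blast+
    then show "openin (subtopology (uniform_direct_limit X \<U>) (limit_map ` K)) (limit_map ` U)"
      using openin_limit_map_image[of U] HK by (simp add: openin_open_subtopology image_mono)
  qed
  show "limit_map ` topspace (subtopology S K) = topspace (subtopology (uniform_direct_limit X \<U>) (limit_map ` K))"
    unfolding topspace_subtopology_K using openin_subset[OF HK] by (simp add: inf.absorb2)
  show "inj_on limit_map (topspace (subtopology S K))"
    unfolding topspace_subtopology_K by (rule inj_on_limit_map)
qed

text \<open>The set \<open>R n\<close> is the image of all points supported at \<open>n\<close>. For
  global charts \<open>R n = X n\<close>, which gives surjectivity; for local ones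
  \<open>R m = B\<close> already contains the prescribed point.\<close>

lemma limit_map_image:
  assumes R: "R m = B" "\<And>n. m \<le> n \<Longrightarrow> R (Suc n) = \<gamma> n ` (R n \<times> V n)" and "m \<le> n"
  shows "R n \<subseteq> limit_map ` K"
proof -
  have "R n = lift n ` support_box (X 0) (\<lambda>n. topspace (C n)) n"
    using assms(3)
  proof (induction rule: dec_induct)
    case base
    have "\<theta> ` W = B"
      using homeomorphic_imp_surjective_map[OF \<theta>] openin_subset[OF W] openin_subset[OF B]
      by (simp add: inf.absorb2)
    moreover have "W \<inter> {q. fst q \<in> X 0 \<and> (\<forall>i<m. snd q i \<in> topspace (C i))} = W"
      using W_subset by (auto simp: topspace_finite_box_product)
    ultimately show ?case
      unfolding lift_box_start R(1) by simp
  next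
    case (step n)
    have "topspace (C n) \<inter> V n = V n"
      using chart_sets(4)[OF step.hyps(1)] by blast
    then show ?case
      using step.IH R(2)[OF step.hyps(1)] lift_box_Suc[OF step.hyps(1), of "X 0" "\<lambda>n. topspace (C n)"] by simp
  qed
  also have "\<dots> \<subseteq> limit_map ` K"
    unfolding support_box_def using limit_map_eq by force
  finally show ?thesis .
qed

end

section \<open>The global and the local case\<close>

theorem theorem1p3:
  fixes X :: "nat \<Rightarrow> 'a set" and \<U> :: "nat \<Rightarrow> 'a rel set"
    and C :: "nat \<Rightarrow> 'c topology" and c :: "nat \<Rightarrow> 'c"
  assumes tower: "uniform_tower X \<U>"
    and tychonoff: "\<And>n. completely_regular_space (C n)" "\<And>n. Hausdorff_space (C n)"
    and pointed: "\<And>n. c n \<in> topspace (C n)"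
  shows
    "((\<forall>n. complemented (C n) (c n) (X (Suc n)) (\<U> (Suc n)) (X n) \<and>
           uniform_topology (X n) (\<U> n) homeomorphic_space
             prod_topology (uniform_topology (X 0) (\<U> 0)) (finite_box_product C c n))
       \<longrightarrow> uniform_direct_limit X \<U> homeomorphic_space
             prod_topology (uniform_topology (X 0) (\<U> 0)) (small_box_product C c))
     \<and>
     ((\<forall>n. locally_complemented (C n) (c n) (X (Suc n)) (\<U> (Suc n)) (X n) \<and>
           locally_homeomorphic_to (uniform_topology (X n) (\<U> n))
             (prod_topology (uniform_topology (X 0) (\<U> 0)) (finite_box_product C c n)))
       \<longrightarrow> locally_homeomorphic_to (uniform_direct_limit X \<U>)
             (prod_topology (uniform_topology (X 0) (\<U> 0)) (small_box_product C c)))"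
proof (intro conjI impI)
  interpret tower X \<U>
    by unfold_locales (rule tower)
  {
    assume *: "\<forall>n. complemented (C n) (c n) (X (Suc n)) (\<U> (Suc n)) (X n) \<and>
      T n homeomorphic_space prod_topology (T 0) (finite_box_product C c n)"
    have "\<exists>\<gamma>. complement_chart (X (Suc n)) (\<U> (Suc n)) (X n) (C n) (c n) (topspace (C n)) (X (Suc n)) \<gamma>" for n
    proof -
      have "induced_uniformity (X (Suc n)) (\<U> (Suc n)) = \<U> (Suc n)"
        using uniformity_stage[of "Suc n" "Suc n"] by simp
      then have "complemented (subtopology (C n) (topspace (C n))) (c n) (X (Suc n))
          (induced_uniformity (X (Suc n)) (\<U> (Suc n))) (X n)"
        using * by (simp add: subtopology_topspace)
      moreover have "openin (T (Suc n)) (X (Suc n))"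
        using openin_topspace[of "T (Suc n)"] topspace_stage by simp
      moreover have "uniform_neighborhood (X (Suc n)) (\<U> (Suc n)) (X n) (X (Suc n))"
        using uniform_structureD(1)[OF unif[of "Suc n"]]
        unfolding uniform_neighborhood_def ent_nbhd_def ent_ball_def by blast
      ultimately show ?thesis
        using complement_chart_of_complemented[OF unif openin_topspace pointed] by metis
    qed
    then obtain \<gamma> where \<gamma>: "\<And>n. complement_chart (X (Suc n)) (\<U> (Suc n)) (X n) (C n) (c n)
        (topspace (C n)) (X (Suc n)) (\<gamma> n)"
      by metis
    \<comment> \<open>The construction starts at stage 0, where the finite product is the single
      point \<open>c\<close> and the first projection is a homeomorphism onto
      \<open>X 0\<close>.\<close>
    let ?F = "prod_topology (T 0) (finite_box_product C c 0)"
    have "topspace (finite_box_product C c 0) = {c}"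
      using pointed by (auto simp: topspace_finite_box_product)
    then have "homeomorphic_map ?F (T 0) fst"
      by (intro bijective_open_imp_homeomorphic_map continuous_map_fst open_map_fst) (auto simp: inj_on_def)
    then have "homeomorphic_map (subtopology ?F (topspace ?F)) (subtopology (T 0) (X 0)) fst"
      using topspace_stage[of 0] by (metis subtopology_topspace)
    moreover have "openin (T 0) (X 0)"
      using openin_topspace[of "T 0"] topspace_stage by simp
    moreover have "openin ?F (topspace ?F)"
      by (rule openin_topspace)
    ultimately interpret chart_tower X \<U> C c 0 "\<lambda>n. topspace (C n)" "\<lambda>n. X (Suc n)" \<gamma> "topspace ?F" "X 0" fst
      by unfold_locales (assumption | rule pointed \<gamma>)+
    \<comment> \<open>All chart domains are whole spaces, so the limit map is defined on the entire
      product.\<close>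
    have K: "K = topspace S"
      using continuous_map_image_subset_topspace[OF continuous_map_truncate]
      unfolding K_def by (auto simp: topspace_small_box_product)
    have "X n \<subseteq> limit_map ` K" for n
      by (rule limit_map_image) (use \<gamma>_image in auto)
    then have "Y \<subseteq> limit_map ` K"
      by blast
    moreover have "limit_map ` K \<subseteq> Y"
      using openin_subset[OF openin_limit_map_image[OF openin_K order_refl]] topspace_limit by simp
    ultimately have "limit_map ` K = topspace (uniform_direct_limit X \<U>)"
      unfolding topspace_limit by simp
    then have "homeomorphic_map S (uniform_direct_limit X \<U>) limit_map"
      using homeomorphic_limit_map unfolding K by (simp only: subtopology_topspace)
    then show "uniform_direct_limit X \<U> homeomorphic_space S"
      using homeomorphic_map_imp_homeomorphic_space homeomorphic_space_sym by blast
  next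
    assume *: "\<forall>n. locally_complemented (C n) (c n) (X (Suc n)) (\<U> (Suc n)) (X n) \<and>
      locally_homeomorphic_to (T n) (prod_topology (T 0) (finite_box_product C c n))"
    have "\<exists>V N \<gamma>. complement_chart (X (Suc n)) (\<U> (Suc n)) (X n) (C n) (c n) V N \<gamma>" for n
    proof -
      obtain V N where "openin (C n) V" "c n \<in> V" "openin (T (Suc n)) N"
        "uniform_neighborhood (X (Suc n)) (\<U> (Suc n)) (X n) N"
        "complemented (subtopology (C n) V) (c n) N (induced_uniformity N (\<U> (Suc n))) (X n)"
        using * unfolding locally_complemented_def by meson
      from complement_chart_of_complemented[OF unif this] show ?thesis
        by metis
    qed
    then obtain V N \<gamma> where \<gamma>: "\<And>n. complement_chart (X (Suc n)) (\<U> (Suc n)) (X n) (C n) (c n) (V n) (N n) (\<gamma> n)"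
      by metis
    show "locally_homeomorphic_to (uniform_direct_limit X \<U>) (prod_topology (T 0) (small_box_product C c))"
      unfolding locally_homeomorphic_to_def
    proof
      fix x assume "x \<in> topspace (uniform_direct_limit X \<U>)"
      \<comment> \<open>The starting stage depends on the point, and so does the resulting
        map.\<close>
      then obtain m where m: "x \<in> X m"
        unfolding topspace_limit by blast
      let ?F = "prod_topology (T 0) (finite_box_product C c m)"
      have "locally_homeomorphic_to (T m) ?F"
        using * by blast
      then obtain B W where BW: "openin (T m) B" "x \<in> B" "openin ?F W"
        "subtopology (T m) B homeomorphic_space subtopology ?F W"
        using m topspace_stage[of m] unfolding locally_homeomorphic_to_def by blast
      then obtain \<theta> where "homeomorphic_map (subtopology ?F W) (subtopology (T m) B) \<theta>"
        using homeomorphic_space homeomorphic_space_sym by metis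
      then interpret chart_tower X \<U> C c m V N \<gamma> W B \<theta>
        by unfold_locales (simp_all add: pointed \<gamma> BW)
      \<comment> \<open>The iterated chart images of \<open>B\<close>, with the recursion shifted to
        start at stage \<open>m\<close>.\<close>
      define R where "R n = rec_nat B (\<lambda>i Q. \<gamma> (m + i) ` (Q \<times> V (m + i))) (n - m)" for n
      have "R m \<subseteq> limit_map ` K"
        by (rule limit_map_image) (simp_all add: R_def Suc_diff_le)
      then have "x \<in> limit_map ` K"
        using BW(2) unfolding R_def by auto
      moreover have "openin (uniform_direct_limit X \<U>) (limit_map ` K)"
        by (rule openin_limit_map_image[OF openin_K order_refl])
      moreover have "subtopology (uniform_direct_limit X \<U>) (limit_map ` K) homeomorphic_space subtopology S K"
        using homeomorphic_map_imp_homeomorphic_space[OF homeomorphic_limit_map] homeomorphic_space_sym by blast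
      ultimately show "\<exists>G H. openin (uniform_direct_limit X \<U>) G \<and> x \<in> G \<and> openin S H \<and>
          subtopology (uniform_direct_limit X \<U>) G homeomorphic_space subtopology S H"
        using openin_K by blast
    qed
  }
qed

end
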